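(* Let $A\in\mathbb{R}^{m\times n}$ ($m\ge n$) and $b\in\mathbb{R}^m$. Assume that the problem $\min_x\|Ax-b\|$ is moderately or mildly ill-posed with singular values $\sigma_j=\zeta j^{-\alpha}$, $j=1,2,\dots,n$, where $\alpha>\frac12$ and $\zeta>0$ is some constant, and that the discrete Picard condition with parameter $\beta>0$ holds (in the sense of the context). Let $\mathcal{V}_k=\mathrm{span}\{v_1,\dots,v_k\}$ and $\mathcal{V}_k^R=\mathcal{K}_k(A^TA,A^Tb)$. Then for $k=1,\dots,n-1$, $$\|\sin\Theta(\mathcal{V}_k,\mathcal{V}_k^R)\|=\frac{\|\Delta_k\|}{\sqrt{1+\|\Delta_k\|^2}},\qquad \|\tan\Theta(\mathcal{V}_k,\mathcal{V}_k^R)\|=\|\Delta_k\|,$$ with $$\|\Delta_1\|\le\frac{\sigma_2^{1+\beta}}{\sigma_1^{1+\beta}}\sqrt{\frac{1}{2\alpha-1}},$$ $$\|\Delta_k\|\le\frac{\sigma_{k+1}^{1+\beta}}{\sigma_k^{1+\beta}}\sqrt{\frac{k^2}{4\alpha^2-1}+\frac{k}{2\alpha-1}}\,|L_{k_1}^{(k)}(0)|,\quad k=2,3,\dots,k_0,$$ $$\|\Delta_k\|\le\sqrt{\frac{k^2}{4\alpha^2-1}+\frac{k}{2\alpha-1}}\,|L_{k_1}^{(k)}(0)|,\quad k=k_0+1,\dots,n-1.$$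
   Context: $\|\cdot\|$ is the 2-norm. The SVD of $A$ is $A=U\begin{pmatrix}\Sigma\\ \mathbf{0}\end{pmatrix}V^T$ with $U=(u_1,\dots,u_m)$, $V=(v_1,\dots,v_n)$ orthogonal, $\Sigma=\mathrm{diag}(\sigma_1,\dots,\sigma_n)$, $\sigma_1>\cdots>\sigma_n>0$. $\mathcal{K}_k(A^TA,A^Tb)=\mathrm{span}\{A^Tb,(A^TA)A^Tb,\dots,(A^TA)^{k-1}A^Tb\}$. $\Theta(\mathcal{X},\mathcal{Y})$ denotes the canonical angles between two subspaces of equal dimension. For $k\ge2$, $|L_{k_1}^{(k)}(0)|=\max_{j=1,\dots,k}|L_j^{(k)}(0)|$ with $|L_j^{(k)}(0)|=\prod_{i=1,\,i\ne j}^k\frac{\sigma_i^2}{|\sigma_j^2-\sigma_i^2|}$. Definition of $\Delta_k\in\mathbb{R}^{(n-k)\times k}$ (all $u_i^Tb\ne0$): let $D=\mathrm{diag}(\sigma_iu_i^Tb)\in\mathbb{R}^{n\times n}$ and let $T_k\in\mathbb{R}^{n\times k}$ have $i$-th row $(1,\sigma_i^2,\dots,\sigma_i^{2k-2})$. Partition $D=\mathrm{diag}(D_1,D_2)$ with $D_1\in\mathbb{R}^{k\times k}$ and $T_k=\begin{pmatrix}T_{k1}\\ T_{k2}\end{pmatrix}$ with $T_{k1}\in\mathbb{R}^{k\times k}$ (nonsingular). Then $\Delta_k=D_2T_{k2}T_{k1}^{-1}D_1^{-1}$. Discrete Picard condition and noise model: $b=\hat b+e$ with $|u_i^T\hat b|=\sigma_i^{1+\beta}$,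 $i=1,\dots,n$, $\beta>0$, and $e$ white noise of level $\eta>0$, i.e. $|u_i^Te|\approx\eta$. The transition index $k_0$ is the index at which $|u_{k_0}^T b|\approx|u_{k_0}^T\hat b|>|u_{k_0}^Te|\approx\eta$ and $|u_{k_0+1}^Tb|\approx|u_{k_0+1}^Te|\approx\eta$. These relations are used in the following exact idealized form: $|u_j^Tb|=\sigma_j^{1+\beta}$ for $j\le k_0$; $|u_j^Tb|=\eta$ for $k_0<j\le n$; $|u_{j+1}^Tb|\le|u_j^Tb|$ for $1\le j\le n-1$; and $|u_{k+1}^Tb|/|u_k^Tb|=(\sigma_{k+1}/\sigma_k)^{1+\beta}$ for $k\le k_0$, $|u_{k+1}^Tb|/|u_k^Tb|=1$ for $k>k_0$. *)

theory Defs
  imports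
    Complex_Main
    "Jordan_Normal_Form.VS_Connect"
    "Jordan_Normal_Form.Char_Poly"
    "Jordan_Normal_Form.Gauss_Jordan_Elimination"
begin

text \<open>
  Matrices and vectors of Jordan-Normal-Form are indexed from 0, whereas the scalar
  sequences \<open>\<sigma>\<close>, the Lagrange factors and the indices \<open>k\<close>, \<open>k0\<close>
  are indexed from 1. Thus \<open>\<sigma> (i + 1)\<close> belongs to \<open>col U i\<close>, and the
  vector \<open>u\<^sub>j\<close> is \<open>col U (j - 1)\<close>, for \<open>j\<close> at least 1.
\<close>

definition vec_norm2 :: "real vec \<Rightarrow> real" where
  "vec_norm2 x = sqrt (x \<bullet> x)"

text \<open>The operator norm induced by the Euclidean norm; meant for matrices with at least one column.\<close>
definition mat_norm2 :: "real mat \<Rightarrow> real" where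
  "mat_norm2 M = (SUP x \<in> {x \<in> carrier_vec (dim_col M). vec_norm2 x = 1}. vec_norm2 (M *\<^sub>v x))"

definition is_svd ::
  "nat \<Rightarrow> nat \<Rightarrow> real mat \<Rightarrow> real mat \<Rightarrow> (nat \<Rightarrow> real) \<Rightarrow> real mat \<Rightarrow> bool" where
  "is_svd m n A U \<sigma> V \<longleftrightarrow>
     A \<in> carrier_mat m n \<and> U \<in> carrier_mat m m \<and> V \<in> carrier_mat n n \<and>
     transpose_mat U * U = 1\<^sub>m m \<and> transpose_mat V * V = 1\<^sub>m n \<and>
     (\<forall>j\<in>{1..n}. 0 < \<sigma> j) \<and> (\<forall>j\<in>{1..<n}. \<sigma> (j + 1) < \<sigma> j) \<and>
     A = U * (mat_diag n (\<lambda>i. \<sigma> (i + 1)) @\<^sub>r 0\<^sub>m (m - n) n) * transpose_mat V"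

abbreviation vec_span :: "nat \<Rightarrow> real vec set \<Rightarrow> real vec set" where
  "vec_span n S \<equiv> LinearCombinations.module.span class_ring (module_vec TYPE(real) n) S"

definition krylov_space :: "nat \<Rightarrow> real mat \<Rightarrow> real vec \<Rightarrow> nat \<Rightarrow> real vec set" where
  "krylov_space n M r k = vec_span n {(M ^\<^sub>m i) *\<^sub>v r |i. i < k}"

definition right_singular_space :: "nat \<Rightarrow> real mat \<Rightarrow> nat \<Rightarrow> real vec set" where
  "right_singular_space n V k = vec_span n {col V i |i. i < k}"

definition orthonormal_basis_mat :: "nat \<Rightarrow> real vec set \<Rightarrow> real mat \<Rightarrow> bool" where
  "orthonormal_basis_mat n W Q \<longleftrightarrow>
     Q \<in> carrier_mat n (dim_col Q) \<and> transpose_mat Q * Q = 1\<^sub>m (dim_col Q) \<and>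
     vec_space.col_space n Q = W"

text \<open>Singular values, one for each column of \<open>M\<close>, with multiplicity and in decreasing order.\<close>
definition singular_values :: "real mat \<Rightarrow> real list" where
  "singular_values M =
     rev (sorted_list_of_multiset (image_mset sqrt (proots (char_poly (transpose_mat M * M)))))"

text \<open>
  The cosines of the canonical angles between two subspaces of equal dimension are the singular
  values of \<open>P\<^sup>T Q\<close>, where the columns of \<open>P\<close> and \<open>Q\<close> form
  orthonormal bases of the subspaces. Another choice of bases multiplies this matrix by
  orthogonal matrices from both sides, so the angles do not depend on it.
\<close>
definition canonical_angles :: "nat \<Rightarrow> real vec set \<Rightarrow> real vec set \<Rightarrow> real list" where
  "canonical_angles n X Y =
     (let P = (SOME P. orthonormal_basis_mat n X P);
          Q = (SOME Q. orthonormal_basis_mat n Y Q)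
      in map arccos (singular_values (transpose_mat P * Q)))"

definition sin_Theta :: "nat \<Rightarrow> real vec set \<Rightarrow> real vec set \<Rightarrow> real mat" where
  "sin_Theta n X Y =
     (let \<theta> = canonical_angles n X Y in mat_diag (length \<theta>) (\<lambda>i. sin (\<theta> ! i)))"

text \<open>
  In HOL \<open>tan (pi / 2) = 0\<close>, so this is the intended matrix only if all the angles are
  less than \<open>pi / 2\<close>, equivalently if \<open>sin_Theta\<close> has norm less than 1.
\<close>
definition tan_Theta :: "nat \<Rightarrow> real vec set \<Rightarrow> real vec set \<Rightarrow> real mat" where
  "tan_Theta n X Y =
     (let \<theta> = canonical_angles n X Y in mat_diag (length \<theta>) (\<lambda>i. tan (\<theta> ! i)))"

text \<open>
  \<open>mat_inverse\<close> returns an option; it is \<open>Some\<close> on both inverted blocks as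
  soon as the \<open>\<sigma>\<close> are positive and distinct and no
  \<open>col U i \<bullet> b\<close> vanishes.
\<close>
definition Delta ::
  "nat \<Rightarrow> real mat \<Rightarrow> (nat \<Rightarrow> real) \<Rightarrow> real vec \<Rightarrow> nat \<Rightarrow> real mat" where
  "Delta n U \<sigma> b k =
     (let D = mat_diag n (\<lambda>i. \<sigma> (i + 1) * (col U i \<bullet> b));
          T = mat n k (\<lambda>(i, j). \<sigma> (i + 1) ^ (2 * j));
          (D1, _, _, D2) = split_block D k k;
          (T1, _, T2, _) = split_block T k k
      in D2 * T2 * the (mat_inverse T1) * the (mat_inverse D1))"

text \<open>
  \<open>lagrange0 \<sigma> k j\<close> is the absolute value at 0 of the \<open>j\<close>-th Lagrange
  basis polynomial for the nodes \<open>\<sigma> 1 ^ 2, \<dots>, \<sigma> k ^ 2\<close>.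
\<close>
definition lagrange0 :: "(nat \<Rightarrow> real) \<Rightarrow> nat \<Rightarrow> nat \<Rightarrow> real" where
  "lagrange0 \<sigma> k j = (\<Prod>i\<in>{1..k} - {j}. (\<sigma> i)\<^sup>2 / \<bar>(\<sigma> j)\<^sup>2 - (\<sigma> i)\<^sup>2\<bar>)"

definition lagrange0_max :: "(nat \<Rightarrow> real) \<Rightarrow> nat \<Rightarrow> real" where
  "lagrange0_max \<sigma> k = Max (lagrange0 \<sigma> k ` {1..k})"

text \<open>
  The discrete Picard condition for the noise-free part \<open>bhat\<close> and the transition index
  \<open>k0\<close>. The approximate relations between the coefficients of \<open>b\<close>,
  \<open>bhat\<close> and the noise \<open>e\<close> of level \<open>\<eta>\<close> enter in idealized form as
  exact relations for the coefficients of \<open>b\<close>; nothing further is required of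
  \<open>e\<close>. At \<open>k = k0\<close> the coefficient and ratio relations force
  \<open>\<eta> = \<sigma> (k0 + 1) powr (1 + \<beta>)\<close>.
\<close>
definition discrete_picard ::
  "nat \<Rightarrow> nat \<Rightarrow> real mat \<Rightarrow> (nat \<Rightarrow> real) \<Rightarrow> real \<Rightarrow> real \<Rightarrow> nat \<Rightarrow>
    real vec \<Rightarrow> real vec \<Rightarrow> real vec \<Rightarrow> bool" where
  "discrete_picard m n U \<sigma> \<beta> \<eta> k0 b bhat e \<longleftrightarrow>
     0 < \<beta> \<and> 0 < \<eta> \<and> 1 \<le> k0 \<and> k0 < n \<and>
     b \<in> carrier_vec m \<and> bhat \<in> carrier_vec m \<and> e \<in> carrier_vec m \<and> b = bhat + e \<and>
     (let c = (\<lambda>j. \<bar>col U (j - 1) \<bullet> b\<bar>); chat = (\<lambda>j. \<bar>col U (j - 1) \<bullet> bhat\<bar>) in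
       (\<forall>j\<in>{1..n}. chat j = \<sigma> j powr (1 + \<beta>)) \<and>
       chat k0 > \<eta> \<and>
       (\<forall>j\<in>{1..k0}. c j = \<sigma> j powr (1 + \<beta>)) \<and>
       (\<forall>j\<in>{k0<..n}. c j = \<eta>) \<and>
       (\<forall>j\<in>{1..<n}. c (j + 1) \<le> c j) \<and>
       (\<forall>k\<in>{1..k0}. c (k + 1) / c k = (\<sigma> (k + 1) / \<sigma> k) powr (1 + \<beta>)) \<and>
       (\<forall>k\<in>{k0<..<n}. c (k + 1) / c k = 1))"

end

theory Submission
  imports Defs
begin

text \<open>
  In the basis of the right singular vectors the Krylov vectors \<open>(A\<^sup>T A)\<^sup>j A\<^sup>T b\<close> are the
  columns of a diagonal matrix times a Vandermonde matrix. The upper block of this product is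
  invertible, and multiplying by its inverse from the right leaves the identity above and
  \<open>Delta\<close> below. So the Krylov space is the graph of \<open>Delta\<close> over the span of the leading
  singular vectors (\<open>krylov_space_eq_graph\<close>).

  The angles between a subspace and the graph of a map \<open>\<Delta>\<close> over it have the singular values of
  \<open>\<Delta>\<close> as their tangents. Only the largest angle enters the two norms, and
  it can be found from Rayleigh quotients alone: the squared cosines are the eigenvalues of a matrix
  whose Rayleigh quotients are at least \<open>1 / (1 + s\<^sup>2)\<close>, with \<open>s\<close> the norm of \<open>\<Delta>\<close>
  (\<open>eigenvalue_bounds\<close>), and a vector at which \<open>\<Delta>\<close> attains its norm gives equality
  (\<open>eigenvalue_attained\<close>). Sine and tangent of the largest angle are then
  \<open>s / sqrt (1 + s\<^sup>2)\<close> and \<open>s\<close>.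

  For the bounds, the columns of the inverse Vandermonde block hold the coefficients of the
  Lagrange basis polynomials, so the entries of \<open>Delta\<close> contain the values of these
  polynomials at the trailing squared singular values. Those lie between 0 and all nodes, where a
  Lagrange basis polynomial is largest in absolute value at 0. The coefficient ratios of \<open>b\<close> are
  bounded by the ratio at \<open>k\<close>, because the coefficients decrease. What is left of
  the Frobenius norm is the product of the sums of \<open>i powr (- 2 * \<alpha>)\<close> over \<open>i > k\<close> and of
  \<open>j powr (2 * \<alpha>)\<close> over \<open>j \<le> k\<close>, and comparison with integrals gives the square root in the
  statement (\<open>norm_Delta_le\<close>, \<open>sum_powr_product_le\<close>).
\<close>

section \<open>The operator norm\<close>
lemma scalar_prod_self_nonneg: "0 \<le> (x :: real vec) \<bullet> x"
  by (auto simp: scalar_prod_def intro: sum_nonneg)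

lemma scalar_prod_self_eq_0:
  "x \<in> carrier_vec n \<Longrightarrow> (x :: real vec) \<bullet> x = 0 \<longleftrightarrow> x = 0\<^sub>v n"
  using conjugate_square_eq_0_vec[of x n] by simp

lemma vec_norm2_sq: "(vec_norm2 x)\<^sup>2 = x \<bullet> x"
  by (simp add: vec_norm2_def scalar_prod_self_nonneg)

lemma vec_norm2_nonneg: "0 \<le> vec_norm2 x"
  by (simp add: vec_norm2_def scalar_prod_self_nonneg)

lemma vec_norm2_smult:
  "x \<in> carrier_vec n \<Longrightarrow> vec_norm2 (c \<cdot>\<^sub>v x) = \<bar>c\<bar> * vec_norm2 x"
  by (simp add: vec_norm2_def real_sqrt_mult mult.assoc[symmetric])

lemma vec_norm2_eq_0: "x \<in> carrier_vec n \<Longrightarrow> vec_norm2 x = 0 \<longleftrightarrow> x = 0\<^sub>v n"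
  by (simp add: vec_norm2_def scalar_prod_self_eq_0)

lemma scalar_prod_mult_self:
  fixes M :: "real mat"
  assumes "M \<in> carrier_mat r k" "x \<in> carrier_vec k"
  shows "x \<bullet> ((M\<^sup>T * M) *\<^sub>v x) = (M *\<^sub>v x) \<bullet> (M *\<^sub>v x)"
proof -
  have "x \<bullet> ((M\<^sup>T * M) *\<^sub>v x) = x \<bullet> (M\<^sup>T *\<^sub>v (M *\<^sub>v x))"
    using assms by (subst assoc_mult_mat_vec) auto
  also have "\<dots> = (M\<^sup>T *\<^sub>v (M *\<^sub>v x)) \<bullet> x"
    using assms by (intro comm_scalar_prod[of _ k]) auto
  also have "\<dots> = (M *\<^sub>v x) \<bullet> (M *\<^sub>v x)"
    using assms by (intro transpose_vec_mult_scalar) auto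
  finally show ?thesis .
qed

lemma quadratic_nonneg_discriminant:
  fixes a b c :: real
  assumes nonneg: "\<And>t. 0 \<le> a + 2 * t * b + t\<^sup>2 * c" and "0 \<le> c"
  shows "b\<^sup>2 \<le> a * c"
proof (cases "c = 0")
  case True
  have "b = 0"
  proof (rule ccontr)
    assume "b \<noteq> 0"
    then have "2 * (- (a + 1) / (2 * b)) * b = - (a + 1)" by simp
    with nonneg[of "- (a + 1) / (2 * b)"] True show False by simp
  qed
  with True show ?thesis by simp
next
  case False
  with \<open>0 \<le> c\<close> have "0 < c" by simp
  have "0 \<le> a - b\<^sup>2 / c"
    using nonneg[of "- b / c"] False by (simp add: power2_eq_square)
  with \<open>0 < c\<close> show ?thesis by (simp add: field_simps)
qed

text \<open>
  Along each line a positive semidefinite form is a nonnegative quadratic polynomial, whose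
  discriminant is therefore at most zero.
\<close>
lemma psd_Cauchy_Schwarz:
  fixes G :: "real mat"
  assumes G: "G \<in> carrier_mat k k" and sym: "G\<^sup>T = G"
    and psd: "\<And>z. z \<in> carrier_vec k \<Longrightarrow> 0 \<le> z \<bullet> (G *\<^sub>v z)"
    and x: "x \<in> carrier_vec k" and y: "y \<in> carrier_vec k"
  shows "(x \<bullet> (G *\<^sub>v y))\<^sup>2 \<le> (x \<bullet> (G *\<^sub>v x)) * (y \<bullet> (G *\<^sub>v y))"
proof (rule quadratic_nonneg_discriminant)
  fix t :: real
  have Gx: "G *\<^sub>v x \<in> carrier_vec k" and Gy: "G *\<^sub>v y \<in> carrier_vec k"
    using G x y by auto
  have "y \<bullet> (G *\<^sub>v x) = (G *\<^sub>v y) \<bullet> x"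
    using transpose_vec_mult_scalar[OF G x y] sym by simp
  also have "\<dots> = x \<bullet> (G *\<^sub>v y)"
    by (rule comm_scalar_prod[OF Gy x])
  finally have yx: "y \<bullet> (G *\<^sub>v x) = x \<bullet> (G *\<^sub>v y)" .
  have "0 \<le> (x + t \<cdot>\<^sub>v y) \<bullet> (G *\<^sub>v (x + t \<cdot>\<^sub>v y))"
    using x y by (intro psd) auto
  also have "G *\<^sub>v (x + t \<cdot>\<^sub>v y) = G *\<^sub>v x + t \<cdot>\<^sub>v (G *\<^sub>v y)"
    using G x y by (simp add: mult_add_distrib_mat_vec[of _ k k] mult_mat_vec[of _ k k])
  also have "(x + t \<cdot>\<^sub>v y) \<bullet> (G *\<^sub>v x + t \<cdot>\<^sub>v (G *\<^sub>v y)) =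
      x \<bullet> (G *\<^sub>v x) + 2 * t * (x \<bullet> (G *\<^sub>v y)) + t\<^sup>2 * (y \<bullet> (G *\<^sub>v y))"
    using x y Gx Gy
    by (simp add: add_scalar_prod_distrib[of _ k] scalar_prod_add_distrib[of _ k] yx
        smult_scalar_prod_distrib[of _ k] scalar_prod_smult_distrib[of _ k] power2_eq_square algebra_simps)
  finally show "0 \<le> x \<bullet> (G *\<^sub>v x) + 2 * t * (x \<bullet> (G *\<^sub>v y)) + t\<^sup>2 * (y \<bullet> (G *\<^sub>v y))" .
qed (use psd y in auto)

lemma scalar_prod_Cauchy_Schwarz:
  fixes x y :: "real vec"
  assumes x: "x \<in> carrier_vec k" and y: "y \<in> carrier_vec k"
  shows "(x \<bullet> y)\<^sup>2 \<le> (x \<bullet> x) * (y \<bullet> y)"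
  using psd_Cauchy_Schwarz[of "1\<^sub>m k" k x y] assms by (simp add: scalar_prod_self_nonneg)

lemma mult_mat_vec_Frobenius:
  fixes M :: "real mat"
  assumes M: "M \<in> carrier_mat r k" and x: "x \<in> carrier_vec k"
  shows "(M *\<^sub>v x) \<bullet> (M *\<^sub>v x) \<le> (\<Sum>i<r. \<Sum>j<k. (M $$ (i, j))\<^sup>2) * (x \<bullet> x)"
proof -
  have row: "row M i \<bullet> row M i = (\<Sum>j<k. (M $$ (i, j))\<^sup>2)" if "i < r" for i
    using M that by (auto simp: scalar_prod_def power2_eq_square atLeast0LessThan)
  have "(M *\<^sub>v x) \<bullet> (M *\<^sub>v x) = (\<Sum>i<r. (row M i \<bullet> x)\<^sup>2)"
    using M by (subst scalar_prod_def) (auto simp: power2_eq_square atLeast0LessThan)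
  also have "\<dots> \<le> (\<Sum>i<r. (row M i \<bullet> row M i) * (x \<bullet> x))"
    using M x by (intro sum_mono scalar_prod_Cauchy_Schwarz[of _ k]) auto
  also have "\<dots> = (\<Sum>i<r. \<Sum>j<k. (M $$ (i, j))\<^sup>2) * (x \<bullet> x)"
    using row by (simp add: sum_distrib_right)
  finally show ?thesis .
qed

lemma exists_unit_vec:
  assumes "1 \<le> k"
  shows "\<exists>x \<in> carrier_vec k. vec_norm2 x = 1"
  using assms by (intro bexI[of _ "unit_vec k 0"]) (auto simp: vec_norm2_def)

lemma mat_norm2_bdd_above:
  fixes M :: "real mat"
  assumes M: "M \<in> carrier_mat r k"
  shows "bdd_above ((\<lambda>x. vec_norm2 (M *\<^sub>v x)) ` {x \<in> carrier_vec (dim_col M). vec_norm2 x = 1})"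
proof (rule bdd_aboveI2)
  fix x assume x: "x \<in> {x \<in> carrier_vec (dim_col M). vec_norm2 x = 1}"
  then have "x \<bullet> x = 1" using vec_norm2_sq[of x] by simp
  then show "vec_norm2 (M *\<^sub>v x) \<le> sqrt (\<Sum>i<r. \<Sum>j<k. (M $$ (i, j))\<^sup>2)"
    using mult_mat_vec_Frobenius[OF M, of x] M x by (auto simp: vec_norm2_def)
qed

text \<open>
  The supremum that defines the norm ranges over the unit sphere, which is empty in dimension
  zero. This is why estimates from above require at least one column.
\<close>
lemma mat_norm2_least:
  assumes M: "M \<in> carrier_mat r k" and k: "1 \<le> k"
    and bound: "\<And>x. x \<in> carrier_vec k \<Longrightarrow> vec_norm2 x = 1 \<Longrightarrow> vec_norm2 (M *\<^sub>v x) \<le> c"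
  shows "mat_norm2 M \<le> c"
  unfolding mat_norm2_def using exists_unit_vec[OF k] M bound by (intro cSUP_least) auto

lemma mat_norm2_le_Frobenius:
  fixes M :: "real mat"
  assumes M: "M \<in> carrier_mat r k" and k: "1 \<le> k"
  shows "mat_norm2 M \<le> sqrt (\<Sum>i<r. \<Sum>j<k. (M $$ (i, j))\<^sup>2)"
proof (rule mat_norm2_least[OF M k])
  fix x :: "real vec" assume x: "x \<in> carrier_vec k" "vec_norm2 x = 1"
  then have "x \<bullet> x = 1" using vec_norm2_sq[of x] by simp
  then show "vec_norm2 (M *\<^sub>v x) \<le> sqrt (\<Sum>i<r. \<Sum>j<k. (M $$ (i, j))\<^sup>2)"
    using mult_mat_vec_Frobenius[OF M x(1)] by (auto simp: vec_norm2_def)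
qed

lemma mat_norm2_upper:
  assumes M: "M \<in> carrier_mat r k" and "x \<in> carrier_vec k" "vec_norm2 x = 1"
  shows "vec_norm2 (M *\<^sub>v x) \<le> mat_norm2 M"
  unfolding mat_norm2_def
  by (rule cSUP_upper[OF _ mat_norm2_bdd_above[OF M]]) (use assms in auto)

lemma mat_norm2_nonneg:
  assumes M: "M \<in> carrier_mat r k" and k: "1 \<le> k"
  shows "0 \<le> mat_norm2 M"
  using exists_unit_vec[OF k] mat_norm2_upper[OF M] vec_norm2_nonneg order_trans by blast

lemma mult_mat_vec_norm_le:
  fixes M :: "real mat"
  assumes M: "M \<in> carrier_mat r k" and x: "x \<in> carrier_vec k"
  shows "(M *\<^sub>v x) \<bullet> (M *\<^sub>v x) \<le> (mat_norm2 M)\<^sup>2 * (x \<bullet> x)"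
proof (cases "x = 0\<^sub>v k")
  case True
  then show ?thesis using M by (simp add: scalar_prod_def)
next
  case False
  define c where "c = vec_norm2 x"
  have c: "0 < c"
    using vec_norm2_nonneg[of x] vec_norm2_eq_0[OF x] False unfolding c_def by simp
  have "vec_norm2 ((1 / c) \<cdot>\<^sub>v x) = 1"
    using c by (simp add: vec_norm2_smult[OF x] flip: c_def)
  then have "vec_norm2 (M *\<^sub>v ((1 / c) \<cdot>\<^sub>v x)) \<le> mat_norm2 M"
    using x by (intro mat_norm2_upper[OF M]) auto
  also have "M *\<^sub>v ((1 / c) \<cdot>\<^sub>v x) = (1 / c) \<cdot>\<^sub>v (M *\<^sub>v x)"
    using M x by (rule mult_mat_vec)
  also have "vec_norm2 \<dots> = vec_norm2 (M *\<^sub>v x) / c"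
    using c M x by (subst vec_norm2_smult[of _ r]) auto
  finally have "vec_norm2 (M *\<^sub>v x) \<le> mat_norm2 M * c"
    using c by (simp add: field_simps)
  then have "(vec_norm2 (M *\<^sub>v x))\<^sup>2 \<le> (mat_norm2 M * c)\<^sup>2"
    by (intro power_mono vec_norm2_nonneg)
  then show ?thesis
    by (simp add: vec_norm2_sq power_mult_distrib c_def)
qed

text \<open>
  The norm is attained, and at an eigenvector of \<open>M\<^sup>T * M\<close>. The argument is
  algebraic. With \<open>s\<close> the norm, \<open>G = s\<^sup>2 \<cdot>\<^sub>m 1\<^sub>m k - M\<^sup>T * M\<close> is positive
  semidefinite. If \<open>G\<close> had an inverse \<open>H\<close>, the Cauchy-Schwarz inequality for the form of
  \<open>G\<close> at \<open>x\<close> and \<open>H *\<^sub>v x\<close> would bound \<open>x \<bullet> (G *\<^sub>v x)\<close> below by a positive constant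
  on the unit sphere, so \<open>M\<close> would stay strictly below \<open>s\<close> there, against the definition of
  \<open>s\<close> as a supremum. Hence \<open>G\<close> is singular, and a kernel vector of \<open>G\<close> is the eigenvector.
\<close>
lemma mat_norm2_right_singular_vector:
  fixes M :: "real mat"
  assumes M: "M \<in> carrier_mat r k" and k: "1 \<le> k"
  obtains x where "x \<in> carrier_vec k" "x \<noteq> 0\<^sub>v k"
    "(M\<^sup>T * M) *\<^sub>v x = (mat_norm2 M)\<^sup>2 \<cdot>\<^sub>v x"
proof -
  define s where "s = mat_norm2 M"
  define G where "G = s\<^sup>2 \<cdot>\<^sub>m 1\<^sub>m k - M\<^sup>T * M"
  have MM: "M\<^sup>T * M \<in> carrier_mat k k" using M by auto
  then have G: "G \<in> carrier_mat k k" unfolding G_def by (rule minus_carrier_mat)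
  have sym: "G\<^sup>T = G"
  proof -
    have "(M\<^sup>T * M)\<^sup>T = M\<^sup>T * M"
      using M by (simp add: transpose_mult[of "M\<^sup>T" k r])
    moreover have "G\<^sup>T = s\<^sup>2 \<cdot>\<^sub>m 1\<^sub>m k - (M\<^sup>T * M)\<^sup>T"
      unfolding G_def using M by (intro eq_matI) auto
    ultimately show ?thesis by (simp add: G_def)
  qed
  have Gz: "G *\<^sub>v z = s\<^sup>2 \<cdot>\<^sub>v z - (M\<^sup>T * M) *\<^sub>v z" if z: "z \<in> carrier_vec k" for z
  proof -
    have "(s\<^sup>2 \<cdot>\<^sub>m 1\<^sub>m k) *\<^sub>v z = s\<^sup>2 \<cdot>\<^sub>v z"
      using z by (intro eq_vecI) auto
    then show ?thesis
      unfolding G_def using z MM by (simp add: minus_mult_distrib_mat_vec[of _ k k])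
  qed
  have form: "z \<bullet> (G *\<^sub>v z) = s\<^sup>2 * (z \<bullet> z) - (M *\<^sub>v z) \<bullet> (M *\<^sub>v z)"
    if z: "z \<in> carrier_vec k" for z
    using z MM mult_mat_vec_carrier[OF MM z] scalar_prod_mult_self[OF M z]
    by (simp add: Gz scalar_prod_minus_distrib[of _ k])
  have psd: "0 \<le> z \<bullet> (G *\<^sub>v z)" if z: "z \<in> carrier_vec k" for z
    using mult_mat_vec_norm_le[OF M z] by (simp add: form[OF z] s_def)
  have "det G = 0"
  proof (rule ccontr)
    assume "det G \<noteq> 0"
    then obtain H where H: "H \<in> carrier_mat k k" and GH: "G * H = 1\<^sub>m k"
      using det_non_zero_imp_unit[OF G, of undefined] G
      unfolding Units_def by (auto simp: ring_mat_simps)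
    \<comment> \<open>The summand 1 only makes the bound positive.\<close>
    define h where "h = mat_norm2 H + 1"
    have h: "1 \<le> h" using mat_norm2_nonneg[OF H k] by (simp add: h_def)
    have gap: "1 / h \<le> x \<bullet> (G *\<^sub>v x)"
      if x: "x \<in> carrier_vec k" and norm: "vec_norm2 x = 1" for x
    proof -
      have Hx: "H *\<^sub>v x \<in> carrier_vec k" using H x by auto
      have xx: "x \<bullet> x = 1" using norm vec_norm2_sq[of x] by simp
      have GHx: "G *\<^sub>v (H *\<^sub>v x) = x"
        using GH G H x by (simp flip: assoc_mult_mat_vec[of _ k k])
      have "((H *\<^sub>v x) \<bullet> x)\<^sup>2 \<le> ((H *\<^sub>v x) \<bullet> (H *\<^sub>v x)) * (x \<bullet> x)"
        using scalar_prod_Cauchy_Schwarz[OF Hx x] .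
      also have "\<dots> \<le> (mat_norm2 H)\<^sup>2"
        using mult_mat_vec_norm_le[OF H x] xx by simp
      also have "\<dots> \<le> h\<^sup>2"
        using mat_norm2_nonneg[OF H k] by (intro power_mono) (auto simp: h_def)
      finally have Hh: "(H *\<^sub>v x) \<bullet> x \<le> h"
        using h by (auto intro: power2_le_imp_le)
      have "1 = (x \<bullet> (G *\<^sub>v (H *\<^sub>v x)))\<^sup>2" by (simp add: GHx xx)
      also have "\<dots> \<le> (x \<bullet> (G *\<^sub>v x)) * ((H *\<^sub>v x) \<bullet> (G *\<^sub>v (H *\<^sub>v x)))"
        by (rule psd_Cauchy_Schwarz[OF G sym psd x Hx])
      also have "\<dots> \<le> (x \<bullet> (G *\<^sub>v x)) * h"
        using Hh psd[OF x] by (simp add: GHx mult_left_mono)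
      finally show ?thesis using h by (simp add: field_simps)
    qed
    have "s \<le> sqrt (s\<^sup>2 - 1 / h)"
      unfolding s_def[symmetric]
    proof (subst (1) s_def, rule mat_norm2_least[OF M k])
      fix x :: "real vec" assume x: "x \<in> carrier_vec k" "vec_norm2 x = 1"
      then have "x \<bullet> x = 1" using vec_norm2_sq[of x] by simp
      then show "vec_norm2 (M *\<^sub>v x) \<le> sqrt (s\<^sup>2 - 1 / h)"
        using gap[OF x] form[OF x(1)] by (auto simp: vec_norm2_def)
    qed
    moreover have "sqrt (s\<^sup>2 - 1 / h) < sqrt (s\<^sup>2)"
      using h by (subst real_sqrt_less_iff) simp
    moreover have "0 \<le> s" using mat_norm2_nonneg[OF M k] by (simp add: s_def)
    ultimately show False by simp
  qed
  then obtain x where x: "x \<in> carrier_vec k" "x \<noteq> 0\<^sub>v k" and Gx: "G *\<^sub>v x = 0\<^sub>v k"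
    using det_0_iff_vec_prod_zero_field[OF G] by blast
  have "(M\<^sup>T * M) *\<^sub>v x = s\<^sup>2 \<cdot>\<^sub>v x"
  proof (rule eq_vecI)
    fix i assume i: "i < dim_vec (s\<^sup>2 \<cdot>\<^sub>v x)"
    have "(s\<^sup>2 \<cdot>\<^sub>v x - (M\<^sup>T * M) *\<^sub>v x) $ i = 0"
      using Gx Gz[OF x(1)] i x(1) by simp
    then show "((M\<^sup>T * M) *\<^sub>v x) $ i = (s\<^sup>2 \<cdot>\<^sub>v x) $ i"
      using i x(1) M by simp
  qed (use M x in auto)
  then show ?thesis using that x by (simp add: s_def)
qed

lemma mat_norm2_mat_diag:
  assumes i: "i < l" and bound: "\<And>j. j < l \<Longrightarrow> \<bar>f j\<bar> \<le> f i"
  shows "mat_norm2 (mat_diag l f) = f i"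
proof (rule antisym)
  have M: "mat_diag l f \<in> carrier_mat l l" by simp
  have fi: "0 \<le> f i" using bound[OF i] by linarith
  have entry: "(mat_diag l f *\<^sub>v x) $ j = f j * x $ j" if "x \<in> carrier_vec l" "j < l" for x j
    using that by (auto simp: mat_diag_def scalar_prod_def if_distrib[of "\<lambda>t. t * _"] cong: if_cong)
  show "mat_norm2 (mat_diag l f) \<le> f i"
  proof (rule mat_norm2_least[OF M])
    fix x :: "real vec" assume x: "x \<in> carrier_vec l" "vec_norm2 x = 1"
    have "(mat_diag l f *\<^sub>v x) \<bullet> (mat_diag l f *\<^sub>v x) = (\<Sum>j<l. (f j)\<^sup>2 * (x $ j)\<^sup>2)"
      using x by (subst scalar_prod_def)
        (auto simp: mat_diag_def entry[unfolded mat_diag_def] power2_eq_square atLeast0LessThan ac_simps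
          simp del: index_mult_mat_vec intro!: sum.cong)
    also have "\<dots> \<le> (\<Sum>j<l. (f i)\<^sup>2 * (x $ j)\<^sup>2)"
      using bound fi by (intro sum_mono mult_right_mono) (auto intro: abs_le_square_iff[THEN iffD1])
    also have "\<dots> = (f i)\<^sup>2 * (x \<bullet> x)"
      using x by (auto simp: scalar_prod_def sum_distrib_left power2_eq_square atLeast0LessThan)
    also have "x \<bullet> x = 1" using vec_norm2_sq[of x] x by simp
    finally show "vec_norm2 (mat_diag l f *\<^sub>v x) \<le> f i"
      using fi by (auto simp: vec_norm2_def intro: real_le_lsqrt)
  qed (use i in auto)
  have "mat_diag l f *\<^sub>v unit_vec l i = f i \<cdot>\<^sub>v unit_vec l i"
    using i by (intro eq_vecI) (auto simp: entry simp del: index_mult_mat_vec, auto simp: mat_diag_def)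
  then have "vec_norm2 (mat_diag l f *\<^sub>v unit_vec l i) = f i"
    using fi i by (simp add: vec_norm2_smult[of _ l]) (simp add: vec_norm2_def)
  then show "f i \<le> mat_norm2 (mat_diag l f)"
    using mat_norm2_upper[OF M, of "unit_vec l i"] i by (simp add: vec_norm2_def)
qed

section \<open>Orthonormal bases and orthogonal projectors\<close>
lemma mem_col_space_iff:
  fixes B :: "real mat"
  assumes "B \<in> carrier_mat n k"
  shows "w \<in> vec_space.col_space n B \<longleftrightarrow> (\<exists>x\<in>carrier_vec k. B *\<^sub>v x = w)"
  using assms by (auto simp: vec_space.col_space_eq[OF assms])

definition append_col :: "real mat \<Rightarrow> real vec \<Rightarrow> real mat" where
  "append_col M v = mat (dim_row M) (Suc (dim_col M))
     (\<lambda>(i, j). if j < dim_col M then M $$ (i, j) else v $ i)"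

lemma append_col_carrier:
  "M \<in> carrier_mat n k \<Longrightarrow> append_col M v \<in> carrier_mat n (Suc k)"
  by (auto simp: append_col_def)

lemma append_col_mult_vec:
  assumes "M \<in> carrier_mat n k" "v \<in> carrier_vec n" "x \<in> carrier_vec (Suc k)"
  shows "append_col M v *\<^sub>v x = M *\<^sub>v vec k (\<lambda>i. x $ i) + x $ k \<cdot>\<^sub>v v"
  using assms by (intro eq_vecI) (auto simp: append_col_def scalar_prod_def)

lemma mem_col_space_append_col:
  assumes M: "M \<in> carrier_mat n k" and v: "v \<in> carrier_vec n"
  shows "w \<in> vec_space.col_space n (append_col M v) \<longleftrightarrow>
    (\<exists>y\<in>carrier_vec k. \<exists>t. w = M *\<^sub>v y + t \<cdot>\<^sub>v v)"
  unfolding mem_col_space_iff[OF append_col_carrier[OF M]]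
proof
  assume "\<exists>x\<in>carrier_vec (Suc k). append_col M v *\<^sub>v x = w"
  then show "\<exists>y\<in>carrier_vec k. \<exists>t. w = M *\<^sub>v y + t \<cdot>\<^sub>v v"
    using append_col_mult_vec[OF M v] vec_carrier by metis
next
  assume "\<exists>y\<in>carrier_vec k. \<exists>t. w = M *\<^sub>v y + t \<cdot>\<^sub>v v"
  then obtain y t where y: "y \<in> carrier_vec k" and w: "w = M *\<^sub>v y + t \<cdot>\<^sub>v v" by blast
  define x where "x = vec (Suc k) (\<lambda>i. if i < k then y $ i else t)"
  have "vec k (\<lambda>i. x $ i) = y" "x $ k = t" using y by (auto simp: x_def intro: eq_vecI)
  then have "append_col M v *\<^sub>v x = w"
    using append_col_mult_vec[OF M v, of x] by (simp add: x_def w)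
  then show "\<exists>x\<in>carrier_vec (Suc k). append_col M v *\<^sub>v x = w"
    by (intro bexI[of _ x]) (auto simp: x_def)
qed

lemma orthonormal_append_col:
  assumes Q: "Q \<in> carrier_mat n q" "Q\<^sup>T * Q = 1\<^sub>m q"
    and u: "u \<in> carrier_vec n" "Q\<^sup>T *\<^sub>v u = 0\<^sub>v q" "u \<bullet> u = 1"
  shows "(append_col Q u)\<^sup>T * append_col Q u = 1\<^sub>m (Suc q)"
proof (rule eq_matI)
  have col: "col (append_col Q u) j = (if j < q then col Q j else u)" if "j < Suc q" for j
    using that Q u by (auto simp: append_col_def intro!: eq_vecI)
  have qq: "col Q i \<bullet> col Q j = (if i = j then 1 else 0)" if "i < q" "j < q" for i j
  proof -
    have "col Q i \<bullet> col Q j = (Q\<^sup>T * Q) $$ (i, j)" using that Q(1) by simp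
    also have "\<dots> = 1\<^sub>m q $$ (i, j)" by (simp only: Q(2))
    finally show ?thesis using that by simp
  qed
  have qu: "col Q i \<bullet> u = 0" if "i < q" for i
  proof -
    have "col Q i \<bullet> u = (Q\<^sup>T *\<^sub>v u) $ i" using that Q by simp
    then show ?thesis using that u(2) by simp
  qed
  have uq: "u \<bullet> col Q i = 0" if "i < q" for i
    using qu[OF that] comm_scalar_prod[of u n "col Q i"] u Q by auto
  fix i j assume "i < dim_row (1\<^sub>m (Suc q))" "j < dim_col (1\<^sub>m (Suc q))"
  then have ij: "i < Suc q" "j < Suc q" by auto
  have "((append_col Q u)\<^sup>T * append_col Q u) $$ (i, j) = col (append_col Q u) i \<bullet> col (append_col Q u) j"
    using ij Q by (auto simp: append_col_def)
  also have "\<dots> = (1\<^sub>m (Suc q) :: real mat) $$ (i, j)"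
    using ij u(3) by (auto simp: col qq qu uq)
  finally show "((append_col Q u)\<^sup>T * append_col Q u) $$ (i, j) = 1\<^sub>m (Suc q) $$ (i, j)" .
qed (use Q in \<open>auto simp: append_col_def\<close>)

text \<open>
  Gram-Schmidt, by induction on the number of columns. A column that depends on the earlier ones
  is dropped, so the columns may be linearly dependent and the orthonormal basis may be smaller.
\<close>
lemma exists_orthonormal_basis_mat:
  fixes B :: "real mat"
  assumes "B \<in> carrier_mat n k"
  shows "\<exists>Q. orthonormal_basis_mat n (vec_space.col_space n B) Q"
  using assms
proof (induction k arbitrary: B)
  case 0
  then have "B\<^sup>T * B = 1\<^sub>m 0" by (intro eq_matI) auto
  with 0 show ?case unfolding orthonormal_basis_mat_def by (intro exI[of _ B]) auto
next
  case (Suc k)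
  define B' where "B' = mat n k (\<lambda>(i, j). B $$ (i, j))"
  define v where "v = col B k"
  have B': "B' \<in> carrier_mat n k" and v: "v \<in> carrier_vec n"
    using Suc.prems by (auto simp: B'_def v_def)
  have B_split: "B = append_col B' v"
    using Suc.prems by (intro eq_matI) (auto simp: append_col_def B'_def v_def less_Suc_eq)
  obtain Q where "orthonormal_basis_mat n (vec_space.col_space n B') Q"
    using Suc.IH[OF B'] by blast
  then obtain q where Q: "Q \<in> carrier_mat n q" and QQ: "Q\<^sup>T * Q = 1\<^sub>m q"
    and col_Q: "vec_space.col_space n Q = vec_space.col_space n B'"
    unfolding orthonormal_basis_mat_def by blast
  have mem_B: "w \<in> vec_space.col_space n B \<longleftrightarrow>
      (\<exists>y\<in>carrier_vec q. \<exists>t. w = Q *\<^sub>v y + t \<cdot>\<^sub>v v)" for w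
  proof -
    have "(\<exists>x\<in>carrier_vec k. B' *\<^sub>v x = z) \<longleftrightarrow> (\<exists>y\<in>carrier_vec q. Q *\<^sub>v y = z)" for z
      using col_Q mem_col_space_iff[OF Q] mem_col_space_iff[OF B'] by blast
    then show ?thesis
      unfolding B_split mem_col_space_append_col[OF B' v] by metis
  qed
  define z where "z = Q\<^sup>T *\<^sub>v v"
  define r where "r = v - Q *\<^sub>v z"
  have z: "z \<in> carrier_vec q" and r: "r \<in> carrier_vec n"
    using Q v by (auto simp: z_def r_def)
  have Qy: "Q *\<^sub>v y \<in> carrier_vec n" if "y \<in> carrier_vec q" for y
    using Q that by auto
  show ?case
  proof (cases "r = 0\<^sub>v n")
    case True
    have vz: "v = Q *\<^sub>v z"
    proof (rule eq_vecI)
      fix i assume "i < dim_vec (Q *\<^sub>v z)"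
      then have i: "i < n" using Q by simp
      then have "(v - Q *\<^sub>v z) $ i = 0" using True by (simp add: r_def)
      then show "v $ i = (Q *\<^sub>v z) $ i" using i Q v by simp
    qed (use Q v in auto)
    have shift: "Q *\<^sub>v y + t \<cdot>\<^sub>v v = Q *\<^sub>v (y + t \<cdot>\<^sub>v z)" if "y \<in> carrier_vec q" for y t
      using that z Q
      by (simp add: vz mult_add_distrib_mat_vec[of _ n q] mult_mat_vec[of _ n q])
    have "w \<in> vec_space.col_space n B \<longleftrightarrow> w \<in> vec_space.col_space n Q" for w
    proof
      assume "w \<in> vec_space.col_space n B"
      then obtain y t where "y \<in> carrier_vec q" "w = Q *\<^sub>v y + t \<cdot>\<^sub>v v"
        using mem_B by blast
      with shift z show "w \<in> vec_space.col_space n Q"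
        unfolding mem_col_space_iff[OF Q] by (intro bexI[of _ "y + t \<cdot>\<^sub>v z"]) auto
    next
      assume "w \<in> vec_space.col_space n Q"
      then obtain y where y: "y \<in> carrier_vec q" "w = Q *\<^sub>v y"
        unfolding mem_col_space_iff[OF Q] by blast
      then have "w = Q *\<^sub>v y + 0 \<cdot>\<^sub>v v" using Q v by (intro eq_vecI) auto
      with y show "w \<in> vec_space.col_space n B" using mem_B by blast
    qed
    then have "orthonormal_basis_mat n (vec_space.col_space n B) Q"
      unfolding orthonormal_basis_mat_def using Q QQ by auto
    then show ?thesis by blast
  next
    case False
    define c where "c = vec_norm2 r"
    have c: "0 < c"
      using vec_norm2_nonneg[of r] vec_norm2_eq_0[OF r] False unfolding c_def by simp
    define u where "u = (1 / c) \<cdot>\<^sub>v r"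
    have u: "u \<in> carrier_vec n" using r by (simp add: u_def)
    have "vec_norm2 u = 1"
      using c by (simp add: u_def vec_norm2_smult[OF r] flip: c_def)
    then have uu: "u \<bullet> u = 1" using vec_norm2_sq[of u] by simp
    have "Q\<^sup>T *\<^sub>v r = Q\<^sup>T *\<^sub>v v - (Q\<^sup>T * Q) *\<^sub>v z"
      using Q v z by (simp add: r_def mult_minus_distrib_mat_vec[of _ q n] assoc_mult_mat_vec[of _ q n])
    also have "\<dots> = 0\<^sub>v q" using z by (simp add: QQ flip: z_def)
    finally have "Q\<^sup>T *\<^sub>v r = 0\<^sub>v q" .
    then have Qu: "Q\<^sup>T *\<^sub>v u = 0\<^sub>v q"
      using Q r by (simp add: u_def mult_mat_vec[of _ q n]) (intro eq_vecI, auto)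
    have v_split: "v = Q *\<^sub>v z + c \<cdot>\<^sub>v u"
      using c Q v by (intro eq_vecI) (auto simp: u_def r_def)
    have shift: "Q *\<^sub>v y + t \<cdot>\<^sub>v v = Q *\<^sub>v (y + t \<cdot>\<^sub>v z) + (t * c) \<cdot>\<^sub>v u"
      if y: "y \<in> carrier_vec q" for y t
    proof -
      have "Q *\<^sub>v (y + t \<cdot>\<^sub>v z) = Q *\<^sub>v y + t \<cdot>\<^sub>v (Q *\<^sub>v z)"
        using y z Q by (simp add: mult_add_distrib_mat_vec[of _ n q] mult_mat_vec[of _ n q])
      moreover have "a + t \<cdot>\<^sub>v (b + c \<cdot>\<^sub>v u) = (a + t \<cdot>\<^sub>v b) + (t * c) \<cdot>\<^sub>v u"
        if "a \<in> carrier_vec n" "b \<in> carrier_vec n" for a b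
        using that u by (intro eq_vecI) (auto simp: algebra_simps)
      ultimately show ?thesis
        using Qy[OF z] Qy[OF y] by (subst v_split) simp
    qed
    have "w \<in> vec_space.col_space n B \<longleftrightarrow> w \<in> vec_space.col_space n (append_col Q u)" for w
      unfolding mem_B mem_col_space_append_col[OF Q u]
    proof
      assume "\<exists>y\<in>carrier_vec q. \<exists>t. w = Q *\<^sub>v y + t \<cdot>\<^sub>v v"
      then obtain y t where "y \<in> carrier_vec q" "w = Q *\<^sub>v y + t \<cdot>\<^sub>v v" by blast
      with shift z show "\<exists>y\<in>carrier_vec q. \<exists>t. w = Q *\<^sub>v y + t \<cdot>\<^sub>v u"
        by (intro bexI[of _ "y + t \<cdot>\<^sub>v z"]) auto
    next
      assume "\<exists>y\<in>carrier_vec q. \<exists>t. w = Q *\<^sub>v y + t \<cdot>\<^sub>v u"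
      then obtain y t where y: "y \<in> carrier_vec q" and w: "w = Q *\<^sub>v y + t \<cdot>\<^sub>v u" by blast
      define y' where "y' = y - (t / c) \<cdot>\<^sub>v z"
      have y': "y' \<in> carrier_vec q" using y z by (simp add: y'_def)
      have "y' + (t / c) \<cdot>\<^sub>v z = y" using y z by (intro eq_vecI) (auto simp: y'_def)
      then have "w = Q *\<^sub>v y' + (t / c) \<cdot>\<^sub>v v" using shift[OF y', of "t / c"] c w by simp
      with y' show "\<exists>y\<in>carrier_vec q. \<exists>t. w = Q *\<^sub>v y + t \<cdot>\<^sub>v v" by blast
    qed
    then have "orthonormal_basis_mat n (vec_space.col_space n B) (append_col Q u)"
      unfolding orthonormal_basis_mat_def
      using append_col_carrier[OF Q, of u] orthonormal_append_col[OF Q QQ u Qu uu] by auto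
    then show ?thesis by blast
  qed
qed

lemma mat_eq_by_mult_vec:
  fixes A B :: "real mat"
  assumes A: "A \<in> carrier_mat n k" and B: "B \<in> carrier_mat n k"
    and eq: "\<And>x. x \<in> carrier_vec k \<Longrightarrow> A *\<^sub>v x = B *\<^sub>v x"
  shows "A = B"
proof (rule eq_matI)
  fix i j assume "i < dim_row B" "j < dim_col B"
  then have ij: "i < n" "j < k" using B by auto
  then have "row A i \<bullet> unit_vec k j = row B i \<bullet> unit_vec k j"
    using eq[of "unit_vec k j"] A B
    by (metis carrier_matD(1) index_mult_mat_vec unit_vec_carrier)
  then show "A $$ (i, j) = B $$ (i, j)" using ij A B by simp
qed (use A B in auto)

lemma orthonormal_basis_matE:
  assumes "orthonormal_basis_mat n W Q"
  obtains q where "Q \<in> carrier_mat n q" "Q\<^sup>T * Q = 1\<^sub>m q" "vec_space.col_space n Q = W"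
  using assms unfolding orthonormal_basis_mat_def by blast

lemma orthonormal_basis_mat_project:
  assumes "orthonormal_basis_mat n W Q" "w \<in> W"
  shows "(Q * Q\<^sup>T) *\<^sub>v w = w"
proof -
  obtain q where Q: "Q \<in> carrier_mat n q" and QQ: "Q\<^sup>T * Q = 1\<^sub>m q"
    and W: "vec_space.col_space n Q = W"
    using assms(1) by (rule orthonormal_basis_matE)
  obtain y where y: "y \<in> carrier_vec q" "w = Q *\<^sub>v y"
    using assms(2) W mem_col_space_iff[OF Q, of w] by blast
  have "(Q * Q\<^sup>T) *\<^sub>v (Q *\<^sub>v y) = Q *\<^sub>v ((Q\<^sup>T * Q) *\<^sub>v y)"
    using Q y by (simp add: assoc_mult_mat_vec[of _ n q _ n] assoc_mult_mat_vec[of _ q n _ q])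
  then show ?thesis using y QQ by simp
qed

text \<open>
  Both sides are the orthogonal projector onto \<open>W\<close>: each absorbs the other from the left, and
  transposition turns this into equality. It makes the canonical angles independent of the
  orthonormal basis chosen for the first subspace.
\<close>
lemma orthonormal_basis_mat_projector_unique:
  assumes P: "orthonormal_basis_mat n W P" and Q: "orthonormal_basis_mat n W Q"
  shows "P * P\<^sup>T = Q * Q\<^sup>T"
proof -
  have carrier: "R * R\<^sup>T \<in> carrier_mat n n" if R: "orthonormal_basis_mat n W R" for R
  proof -
    obtain r where "R \<in> carrier_mat n r" using R by (rule orthonormal_basis_matE)
    then show ?thesis by auto
  qed
  have sym: "(R * R\<^sup>T)\<^sup>T = R * R\<^sup>T" if R: "orthonormal_basis_mat n W R" for R
  proof -
    obtain r where "R \<in> carrier_mat n r" using R by (rule orthonormal_basis_matE)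
    then have "(R * R\<^sup>T)\<^sup>T = R\<^sup>T\<^sup>T * R\<^sup>T" by (intro transpose_mult[of _ n r]) auto
    then show ?thesis by simp
  qed
  have absorb: "(R * R\<^sup>T) * (S * S\<^sup>T) = S * S\<^sup>T"
    if R: "orthonormal_basis_mat n W R" and S: "orthonormal_basis_mat n W S" for R S
  proof (rule mat_eq_by_mult_vec)
    fix x :: "real vec" assume x: "x \<in> carrier_vec n"
    obtain r where S_carrier: "S \<in> carrier_mat n r" and S_W: "vec_space.col_space n S = W"
      using S by (rule orthonormal_basis_matE)
    have "(S * S\<^sup>T) *\<^sub>v x = S *\<^sub>v (S\<^sup>T *\<^sub>v x)"
      using S_carrier x by (intro assoc_mult_mat_vec) auto
    moreover have "S\<^sup>T *\<^sub>v x \<in> carrier_vec r" using S_carrier x by auto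
    ultimately have "(S * S\<^sup>T) *\<^sub>v x \<in> W"
      unfolding S_W[symmetric] mem_col_space_iff[OF S_carrier] by (intro bexI) auto
    then have "(R * R\<^sup>T) *\<^sub>v ((S * S\<^sup>T) *\<^sub>v x) = (S * S\<^sup>T) *\<^sub>v x"
      by (rule orthonormal_basis_mat_project[OF R])
    then show "((R * R\<^sup>T) * (S * S\<^sup>T)) *\<^sub>v x = (S * S\<^sup>T) *\<^sub>v x"
      using carrier[OF R] carrier[OF S] x by (simp add: assoc_mult_mat_vec[of _ n n _ n])
  qed (use carrier[OF R] carrier[OF S] in auto)
  have "P * P\<^sup>T = (P * P\<^sup>T)\<^sup>T" by (simp add: sym[OF P])
  also have "\<dots> = ((Q * Q\<^sup>T) * (P * P\<^sup>T))\<^sup>T" by (simp add: absorb[OF Q P])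
  also have "\<dots> = (P * P\<^sup>T) * (Q * Q\<^sup>T)"
    using transpose_mult[OF carrier[OF Q] carrier[OF P]] sym[OF P] sym[OF Q] by simp
  also have "\<dots> = Q * Q\<^sup>T" by (rule absorb[OF P Q])
  finally show ?thesis .
qed

section \<open>Canonical angles of a graph subspace\<close>

text \<open>
  The norms of the angle matrices are maxima over the angles, so the set of the singular values
  determines them.
\<close>
lemma set_singular_values:
  assumes M: "M \<in> carrier_mat p q"
  shows "set (singular_values M) = sqrt ` {\<mu>. eigenvalue (M\<^sup>T * M) \<mu>}"
proof -
  have MM: "M\<^sup>T * M \<in> carrier_mat q q" using M by auto
  have "char_poly (M\<^sup>T * M) \<noteq> 0"
    using degree_monic_char_poly[OF MM] by auto
  then have "set_mset (proots (char_poly (M\<^sup>T * M))) = {\<mu>. eigenvalue (M\<^sup>T * M) \<mu>}"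
    by (simp add: set_count_proots eigenvalue_root_char_poly[OF MM])
  then show ?thesis unfolding singular_values_def by simp
qed

lemma mult_mat_vec_self_transpose:
  fixes M :: "real mat"
  assumes "M \<in> carrier_mat r k" "x \<in> carrier_vec k" "M\<^sup>T * M = 1\<^sub>m k"
  shows "(M *\<^sub>v x) \<bullet> (M *\<^sub>v x) = x \<bullet> x"
  using scalar_prod_mult_self[OF assms(1,2)] assms(2,3) by simp

text \<open>
  The two subspaces in coordinates: \<open>V1\<close> and \<open>V2\<close> have orthonormal columns that are
  orthogonal to each other, and the second subspace is the graph of \<open>\<Delta>\<close> over the
  first one, spanned by the columns of \<open>V1 + V2 * \<Delta>\<close>.
\<close>
locale graph_subspace =
  fixes n k l :: nat and V1 V2 \<Delta> :: "real mat"
  assumes V1: "V1 \<in> carrier_mat n k" and V2: "V2 \<in> carrier_mat n l"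
    and \<Delta>: "\<Delta> \<in> carrier_mat l k" and k: "1 \<le> k"
    and V1V1: "V1\<^sup>T * V1 = 1\<^sub>m k" and V2V2: "V2\<^sup>T * V2 = 1\<^sub>m l"
    and V1V2: "V1\<^sup>T * V2 = 0\<^sub>m k l"
begin

definition W :: "real mat" where "W = V1 + V2 * \<Delta>"

abbreviation s :: real where "s \<equiv> mat_norm2 \<Delta>"

abbreviation X :: "real vec set" where "X \<equiv> vec_space.col_space n V1"
abbreviation Y :: "real vec set" where "Y \<equiv> vec_space.col_space n W"

lemma W: "W \<in> carrier_mat n k"
  unfolding W_def using V1 V2 \<Delta> by auto

lemma V1_W: "V1\<^sup>T * W = 1\<^sub>m k"
proof -
  have "V1\<^sup>T * W = V1\<^sup>T * V1 + V1\<^sup>T * (V2 * \<Delta>)"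
    unfolding W_def using V1 V2 \<Delta> by (intro mult_add_distrib_mat) auto
  also have "V1\<^sup>T * (V2 * \<Delta>) = (V1\<^sup>T * V2) * \<Delta>"
    using V1 V2 \<Delta> by (intro assoc_mult_mat[symmetric, of _ k n _ l]) auto
  also have "\<dots> = 0\<^sub>m k k" using \<Delta> by (simp add: V1V2)
  finally show ?thesis by (simp add: V1V1)
qed

lemma W_V1: "W\<^sup>T * V1 = 1\<^sub>m k"
  using arg_cong[OF V1_W, of transpose_mat] V1 W by (simp add: transpose_mult[of _ k n])

lemma W_W: "W\<^sup>T * W = 1\<^sub>m k + \<Delta>\<^sup>T * \<Delta>"
proof -
  have V2\<Delta>: "V2 * \<Delta> \<in> carrier_mat n k" using V2 \<Delta> by auto
  have V2_V1: "V2\<^sup>T * V1 = 0\<^sub>m l k"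
    using arg_cong[OF V1V2, of transpose_mat] V1 V2 by (simp add: transpose_mult[of _ k n])
  have V2_W: "V2\<^sup>T * W = \<Delta>"
  proof -
    have "V2\<^sup>T * W = V2\<^sup>T * V1 + V2\<^sup>T * (V2 * \<Delta>)"
      unfolding W_def using V1 V2 \<Delta> by (intro mult_add_distrib_mat) auto
    also have "V2\<^sup>T * (V2 * \<Delta>) = (V2\<^sup>T * V2) * \<Delta>"
      using V2 \<Delta> by (intro assoc_mult_mat[symmetric, of _ l n _ l]) auto
    finally show ?thesis using \<Delta> by (simp add: V2V2 V2_V1)
  qed
  have W_V2: "W\<^sup>T * V2 = \<Delta>\<^sup>T"
    using arg_cong[OF V2_W, of transpose_mat] V2 W by (simp add: transpose_mult[of _ l n])
  have "W\<^sup>T * W = W\<^sup>T * V1 + W\<^sup>T * (V2 * \<Delta>)"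
    using W V1 V2\<Delta> by (subst (2) W_def) (intro mult_add_distrib_mat, auto)
  also have "W\<^sup>T * (V2 * \<Delta>) = (W\<^sup>T * V2) * \<Delta>"
    using W V2 \<Delta> by (intro assoc_mult_mat[symmetric, of _ k n _ l]) auto
  finally show ?thesis by (simp add: W_V1 W_V2)
qed

lemma W_norm:
  assumes x: "x \<in> carrier_vec k"
  shows "(W *\<^sub>v x) \<bullet> (W *\<^sub>v x) = x \<bullet> x + (\<Delta> *\<^sub>v x) \<bullet> (\<Delta> *\<^sub>v x)"
proof -
  have "(W *\<^sub>v x) \<bullet> (W *\<^sub>v x) = x \<bullet> ((1\<^sub>m k + \<Delta>\<^sup>T * \<Delta>) *\<^sub>v x)"
    using scalar_prod_mult_self[OF W x] by (simp add: W_W)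
  also have "(1\<^sub>m k + \<Delta>\<^sup>T * \<Delta>) *\<^sub>v x = x + (\<Delta>\<^sup>T * \<Delta>) *\<^sub>v x"
    using x \<Delta> by (subst add_mult_distrib_mat_vec[of _ k k]) auto
  also have "x \<bullet> \<dots> = x \<bullet> x + x \<bullet> ((\<Delta>\<^sup>T * \<Delta>) *\<^sub>v x)"
    using x \<Delta> by (intro scalar_prod_add_distrib[of _ k]) auto
  finally show ?thesis using scalar_prod_mult_self[OF \<Delta> x] by simp
qed

lemma V1_W_vec: "x \<in> carrier_vec k \<Longrightarrow> V1\<^sup>T *\<^sub>v (W *\<^sub>v x) = x"
  using V1 W by (simp add: V1_W flip: assoc_mult_mat_vec[of _ k n])

context
  fixes P Q :: "real mat" and p q :: nat
  assumes P: "orthonormal_basis_mat n X P" and P_carrier: "P \<in> carrier_mat n p"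
    and Q_carrier: "Q \<in> carrier_mat n q" and Q_Q: "Q\<^sup>T * Q = 1\<^sub>m q"
    and Q_Y: "vec_space.col_space n Q = Y"
begin

text \<open>
  Its eigenvalues are the squared cosines of the canonical angles.
\<close>
definition cos_sq_mat :: "real mat" where "cos_sq_mat = (P\<^sup>T * Q)\<^sup>T * (P\<^sup>T * Q)"

lemma cos_sq_mat_carrier: "cos_sq_mat \<in> carrier_mat q q"
  unfolding cos_sq_mat_def using P_carrier Q_carrier by (intro mult_carrier_mat[of _ q p]) auto

lemma cos_sq_mat_eq: "cos_sq_mat = Q\<^sup>T * (V1 * V1\<^sup>T) * Q"
proof -
  have "orthonormal_basis_mat n X V1"
    using V1 V1V1 by (auto simp: orthonormal_basis_mat_def)
  then have PP: "P * P\<^sup>T = V1 * V1\<^sup>T"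
    using orthonormal_basis_mat_projector_unique[OF P] by blast
  have "cos_sq_mat = (Q\<^sup>T * P) * (P\<^sup>T * Q)"
    unfolding cos_sq_mat_def using P_carrier Q_carrier by (subst transpose_mult[of _ p n]) auto
  also have "\<dots> = Q\<^sup>T * (P * (P\<^sup>T * Q))"
    using P_carrier Q_carrier by (intro assoc_mult_mat[of _ q n _ p]) auto
  also have "P * (P\<^sup>T * Q) = (V1 * V1\<^sup>T) * Q"
    unfolding PP[symmetric] using P_carrier Q_carrier by (intro assoc_mult_mat[symmetric, of _ n p _ n]) auto
  also have "Q\<^sup>T * ((V1 * V1\<^sup>T) * Q) = Q\<^sup>T * (V1 * V1\<^sup>T) * Q"
    using V1 Q_carrier by (intro assoc_mult_mat[symmetric, of _ q n _ n]) auto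
  finally show ?thesis .
qed

text \<open>
  Each vector of the second subspace is both \<open>Q *\<^sub>v y\<close> and \<open>W *\<^sub>v x\<close>, and the two
  coordinate vectors determine each other. Here \<open>x\<close> are the coordinates of the projection to the first
  subspace. Working with both vectors replaces an explicit orthonormal basis of the graph, which
  would involve the inverse square root of \<open>1\<^sub>m k + \<Delta>\<^sup>T * \<Delta>\<close>.
\<close>
lemma cos_sq_mat_mult_vec:
  assumes y: "y \<in> carrier_vec q" and x: "x \<in> carrier_vec k" and eq: "Q *\<^sub>v y = W *\<^sub>v x"
  shows "cos_sq_mat *\<^sub>v y = Q\<^sup>T *\<^sub>v (V1 *\<^sub>v x)"
proof -
  have "cos_sq_mat *\<^sub>v y = (Q\<^sup>T * (V1 * V1\<^sup>T)) *\<^sub>v (Q *\<^sub>v y)"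
    unfolding cos_sq_mat_eq using V1 Q_carrier y by (intro assoc_mult_mat_vec) auto
  also have "\<dots> = Q\<^sup>T *\<^sub>v ((V1 * V1\<^sup>T) *\<^sub>v (W *\<^sub>v x))"
    unfolding eq using V1 Q_carrier W x by (intro assoc_mult_mat_vec) auto
  also have "(V1 * V1\<^sup>T) *\<^sub>v (W *\<^sub>v x) = V1 *\<^sub>v (V1\<^sup>T *\<^sub>v (W *\<^sub>v x))"
    using V1 W x by (intro assoc_mult_mat_vec) auto
  finally show ?thesis by (simp add: V1_W_vec[OF x])
qed

lemma Q_preimage:
  assumes y: "y \<in> carrier_vec q"
  obtains x where "x \<in> carrier_vec k" "Q *\<^sub>v y = W *\<^sub>v x"
proof -
  have "Q *\<^sub>v y \<in> Y" using y Q_Y mem_col_space_iff[OF Q_carrier] by metis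
  then show thesis using that mem_col_space_iff[OF W] by metis
qed

lemma W_preimage:
  assumes x: "x \<in> carrier_vec k"
  obtains y where "y \<in> carrier_vec q" "Q *\<^sub>v y = W *\<^sub>v x"
proof -
  have "W *\<^sub>v x \<in> Y" using x mem_col_space_iff[OF W] by metis
  then show thesis using that mem_col_space_iff[OF Q_carrier] Q_Y by metis
qed

text \<open>
  For an eigenvector \<open>y\<close>, with \<open>x\<close> as above, the eigenvalue is the Rayleigh quotient
  \<open>x \<bullet> x / (x \<bullet> x + (\<Delta> *\<^sub>v x) \<bullet> (\<Delta> *\<^sub>v x))\<close>.
\<close>
lemma eigenvalue_bounds:
  assumes "eigenvalue cos_sq_mat \<mu>"
  shows "1 / (1 + s\<^sup>2) \<le> \<mu>" "\<mu> \<le> 1"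
proof -
  obtain y where y: "y \<in> carrier_vec q" "y \<noteq> 0\<^sub>v q" and Ny: "cos_sq_mat *\<^sub>v y = \<mu> \<cdot>\<^sub>v y"
    using assms cos_sq_mat_carrier unfolding eigenvalue_def eigenvector_def by auto
  obtain x where x: "x \<in> carrier_vec k" and Qy: "Q *\<^sub>v y = W *\<^sub>v x"
    using Q_preimage[OF y(1)] by blast
  have "\<mu> * (y \<bullet> y) = y \<bullet> (cos_sq_mat *\<^sub>v y)" using y by (simp add: Ny)
  also have "\<dots> = y \<bullet> (Q\<^sup>T *\<^sub>v (V1 *\<^sub>v x))" by (simp add: cos_sq_mat_mult_vec[OF y(1) x Qy])
  also have "\<dots> = (Q\<^sup>T *\<^sub>v (V1 *\<^sub>v x)) \<bullet> y"
    using y V1 x Q_carrier by (intro comm_scalar_prod[of _ q]) auto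
  also have "\<dots> = (V1 *\<^sub>v x) \<bullet> (Q *\<^sub>v y)"
    using y V1 x by (intro transpose_vec_mult_scalar[OF Q_carrier]) auto
  also have "\<dots> = (W *\<^sub>v x) \<bullet> (V1 *\<^sub>v x)"
    unfolding Qy using V1 W x by (intro comm_scalar_prod[of _ n]) auto
  also have "\<dots> = (V1\<^sup>T *\<^sub>v (W *\<^sub>v x)) \<bullet> x"
    using V1 W x by (intro transpose_vec_mult_scalar[symmetric]) auto
  finally have num: "\<mu> * (y \<bullet> y) = x \<bullet> x" by (simp add: V1_W_vec[OF x])
  have den: "y \<bullet> y = x \<bullet> x + (\<Delta> *\<^sub>v x) \<bullet> (\<Delta> *\<^sub>v x)"
    using mult_mat_vec_self_transpose[OF Q_carrier y(1) Q_Q] W_norm[OF x] Qy by simp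
  have pos: "0 < y \<bullet> y"
    using scalar_prod_self_nonneg[of y] scalar_prod_self_eq_0[OF y(1)] y(2) by linarith
  have "y \<bullet> y \<le> (1 + s\<^sup>2) * (x \<bullet> x)"
    using mult_mat_vec_norm_le[OF \<Delta> x] den by (simp add: algebra_simps)
  then have "1 * (y \<bullet> y) \<le> ((1 + s\<^sup>2) * \<mu>) * (y \<bullet> y)"
    by (simp only: num[symmetric] mult.assoc mult_1_left)
  then have "1 \<le> (1 + s\<^sup>2) * \<mu>" using pos by (rule mult_right_le_imp_le)
  then show "1 / (1 + s\<^sup>2) \<le> \<mu>"
    by (simp add: divide_le_eq mult.commute add_pos_nonneg)
  have "\<mu> * (y \<bullet> y) \<le> 1 * (y \<bullet> y)"
    using num den scalar_prod_self_nonneg[of "\<Delta> *\<^sub>v x"] by simp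
  then show "\<mu> \<le> 1" using pos by (rule mult_right_le_imp_le)
qed

text \<open>
  The eigenvector belongs to a vector \<open>x\<close> at which \<open>\<Delta>\<close> attains its norm: there
  \<open>V1 *\<^sub>v x\<close> differs from \<open>W *\<^sub>v x / (1 + s\<^sup>2)\<close> by a vector orthogonal to the second
  subspace.
\<close>
lemma eigenvalue_attained: "eigenvalue cos_sq_mat (1 / (1 + s\<^sup>2))"
proof -
  define c where "c = 1 / (1 + s\<^sup>2)"
  have c: "c * (1 + s\<^sup>2) = 1" by (simp add: c_def add_nonneg_eq_0_iff)
  obtain x where x: "x \<in> carrier_vec k" "x \<noteq> 0\<^sub>v k" and \<Delta>x: "(\<Delta>\<^sup>T * \<Delta>) *\<^sub>v x = s\<^sup>2 \<cdot>\<^sub>v x"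
    using mat_norm2_right_singular_vector[OF \<Delta> k] by blast
  obtain y where y: "y \<in> carrier_vec q" and Qy: "Q *\<^sub>v y = W *\<^sub>v x"
    using W_preimage[OF x(1)] by blast
  define r where "r = V1 *\<^sub>v x - c \<cdot>\<^sub>v (W *\<^sub>v x)"
  have Wx: "W *\<^sub>v x \<in> carrier_vec n" and V1x: "V1 *\<^sub>v x \<in> carrier_vec n"
    using W V1 x by auto
  then have r: "r \<in> carrier_vec n" by (simp add: r_def)
  have W_r: "W\<^sup>T *\<^sub>v r = 0\<^sub>v k"
  proof -
    have "W\<^sup>T *\<^sub>v (V1 *\<^sub>v x) = x"
      using W V1 x by (simp add: W_V1 flip: assoc_mult_mat_vec[of _ k n])
    moreover have "W\<^sup>T *\<^sub>v (W *\<^sub>v x) = (1 + s\<^sup>2) \<cdot>\<^sub>v x"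
    proof -
      have "W\<^sup>T *\<^sub>v (W *\<^sub>v x) = (1\<^sub>m k + \<Delta>\<^sup>T * \<Delta>) *\<^sub>v x"
        using W x by (simp flip: W_W add: assoc_mult_mat_vec[of _ k n])
      also have "\<dots> = x + s\<^sup>2 \<cdot>\<^sub>v x"
        using x \<Delta> by (subst add_mult_distrib_mat_vec[of _ k k]) (auto simp: \<Delta>x)
      finally show ?thesis using x by (simp add: add_smult_distrib_vec)
    qed
    ultimately have "W\<^sup>T *\<^sub>v r = x - c \<cdot>\<^sub>v ((1 + s\<^sup>2) \<cdot>\<^sub>v x)"
      unfolding r_def using W Wx V1x
      by (simp add: mult_minus_distrib_mat_vec[of _ k n] mult_mat_vec[of _ k n])
    also have "\<dots> = 0\<^sub>v k" using x c by (simp add: smult_smult_assoc)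
    finally show ?thesis .
  qed
  have Q_r: "Q\<^sup>T *\<^sub>v r = 0\<^sub>v q"
  proof -
    define z where "z = Q\<^sup>T *\<^sub>v r"
    have z: "z \<in> carrier_vec q" using Q_carrier r by (auto simp: z_def)
    obtain w where w: "w \<in> carrier_vec k" "Q *\<^sub>v z = W *\<^sub>v w" using Q_preimage[OF z] by blast
    have "z \<bullet> z = r \<bullet> (Q *\<^sub>v z)"
      unfolding z_def using Q_carrier r by (intro transpose_vec_mult_scalar) auto
    also have "\<dots> = (W\<^sup>T *\<^sub>v r) \<bullet> w"
      unfolding w(2) using W w(1) r by (intro transpose_vec_mult_scalar[symmetric]) auto
    also have "\<dots> = 0" using w(1) by (simp add: W_r)
    finally show ?thesis using scalar_prod_self_eq_0[OF z] by (simp add: z_def)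
  qed
  have "Q\<^sup>T *\<^sub>v (V1 *\<^sub>v x) = c \<cdot>\<^sub>v y"
  proof -
    have "V1 *\<^sub>v x = r + c \<cdot>\<^sub>v (Q *\<^sub>v y)"
      using V1 W unfolding Qy by (intro eq_vecI) (auto simp: r_def)
    then have "Q\<^sup>T *\<^sub>v (V1 *\<^sub>v x) = Q\<^sup>T *\<^sub>v r + c \<cdot>\<^sub>v (Q\<^sup>T *\<^sub>v (Q *\<^sub>v y))"
      using Q_carrier r y Wx Qy
      by (simp add: mult_add_distrib_mat_vec[of _ q n] mult_mat_vec[of _ q n])
    also have "Q\<^sup>T *\<^sub>v (Q *\<^sub>v y) = y"
      using Q_carrier y by (simp add: Q_Q flip: assoc_mult_mat_vec[of _ q n])
    finally show ?thesis using y by (simp add: Q_r)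
  qed
  then have "cos_sq_mat *\<^sub>v y = c \<cdot>\<^sub>v y" by (simp add: cos_sq_mat_mult_vec[OF y x(1) Qy])
  moreover have "y \<noteq> 0\<^sub>v q"
  proof
    assume "y = 0\<^sub>v q"
    then have "W *\<^sub>v x = Q *\<^sub>v 0\<^sub>v q" using Qy by simp
    also have "\<dots> = 0\<^sub>v n" using Q_carrier by (intro eq_vecI) auto
    finally have "W *\<^sub>v x = 0\<^sub>v n" .
    then have "x = 0\<^sub>v k" using V1_W_vec[OF x(1)] V1 by auto
    with x show False by simp
  qed
  ultimately show ?thesis
    using y cos_sq_mat_carrier unfolding eigenvalue_def eigenvector_def c_def by auto
qed

end

lemma set_canonical_angles:
  obtains E where "set (canonical_angles n X Y) = (\<lambda>\<mu>. arccos (sqrt \<mu>)) ` E"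
    "1 / (1 + s\<^sup>2) \<in> E" "E \<subseteq> {1 / (1 + s\<^sup>2)..1}"
proof -
  define P where "P = (SOME P. orthonormal_basis_mat n X P)"
  define Q where "Q = (SOME Q. orthonormal_basis_mat n Y Q)"
  have P: "orthonormal_basis_mat n X P"
    unfolding P_def by (rule someI_ex[OF exists_orthonormal_basis_mat[OF V1]])
  have Q: "orthonormal_basis_mat n Y Q"
    unfolding Q_def by (rule someI_ex[OF exists_orthonormal_basis_mat[OF W]])
  obtain p where p: "P \<in> carrier_mat n p" using P by (rule orthonormal_basis_matE)
  obtain q where q: "Q \<in> carrier_mat n q" "Q\<^sup>T * Q = 1\<^sub>m q" "vec_space.col_space n Q = Y"
    using Q by (rule orthonormal_basis_matE)
  have PQ: "P\<^sup>T * Q \<in> carrier_mat p q" using p q by auto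
  show thesis
  proof (rule that)
    show "set (canonical_angles n X Y) =
      (\<lambda>\<mu>. arccos (sqrt \<mu>)) ` {\<mu>. eigenvalue (cos_sq_mat P Q) \<mu>}"
      unfolding canonical_angles_def Let_def
      by (simp add: set_singular_values[OF PQ] image_image cos_sq_mat_def[OF P p q] flip: P_def Q_def)
  qed (use eigenvalue_bounds[OF P p q] eigenvalue_attained[OF P p q] in auto)
qed

text \<open>
  Sine and tangent decrease in the squared cosine \<open>\<mu>\<close>, so both norms are taken at the smallest
  eigenvalue \<open>1 / (1 + s\<^sup>2)\<close>. As this is positive, no angle is a right angle.
\<close>
lemma norm_sin_Theta: "mat_norm2 (sin_Theta n X Y) = s / sqrt (1 + s\<^sup>2)"
  and norm_tan_Theta: "mat_norm2 (tan_Theta n X Y) = s"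
proof -
  define c where "c = 1 / (1 + s\<^sup>2)"
  define \<theta> where "\<theta> = canonical_angles n X Y"
  obtain E where E: "set \<theta> = (\<lambda>\<mu>. arccos (sqrt \<mu>)) ` E" "c \<in> E" "E \<subseteq> {c..1}"
    using set_canonical_angles unfolding \<theta>_def c_def by blast
  have s: "0 \<le> s" by (rule mat_norm2_nonneg[OF \<Delta> k])
  have s2: "0 < 1 + s\<^sup>2" by (simp add: add_pos_nonneg)
  have c: "0 < c" using s2 by (simp add: c_def)
  have sin_c: "sqrt (1 - c) = s / sqrt (1 + s\<^sup>2)"
  proof -
    have "1 - c = s\<^sup>2 / (1 + s\<^sup>2)" using s2 by (simp add: c_def field_simps)
    then show ?thesis using s by (simp add: real_sqrt_divide)
  qed
  have tan_c: "sqrt (1 - c) / sqrt c = s"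
  proof -
    have "sqrt c = 1 / sqrt (1 + s\<^sup>2)" by (simp add: c_def real_sqrt_divide)
    then show ?thesis using s2 by (simp add: sin_c)
  qed
  have sin_E: "sin (arccos (sqrt \<mu>)) = sqrt (1 - \<mu>)"
    and tan_E: "tan (arccos (sqrt \<mu>)) = sqrt (1 - \<mu>) / sqrt \<mu>" if "\<mu> \<in> E" for \<mu>
  proof -
    have \<mu>: "c \<le> \<mu>" "\<mu> \<le> 1" using that E(3) by auto
    then have "0 \<le> sqrt \<mu>" "sqrt \<mu> \<le> 1" "(sqrt \<mu>)\<^sup>2 = \<mu>" using c by auto
    moreover from this(1) have "- 1 \<le> sqrt \<mu>" by linarith
    ultimately show "sin (arccos (sqrt \<mu>)) = sqrt (1 - \<mu>)"
      "tan (arccos (sqrt \<mu>)) = sqrt (1 - \<mu>) / sqrt \<mu>"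
      by (simp_all add: sin_arccos tan_def cos_arccos del: real_sqrt_le_1_iff real_sqrt_ge_0_iff)
  qed
  obtain i where i: "i < length \<theta>" and \<theta>i: "\<theta> ! i = arccos (sqrt c)"
    using E(1,2) by (metis imageI in_set_conv_nth)
  have "mat_norm2 (mat_diag (length \<theta>) (\<lambda>i. sin (\<theta> ! i))) = sin (\<theta> ! i)"
  proof (rule mat_norm2_mat_diag[OF i])
    fix j assume "j < length \<theta>"
    then obtain \<mu> where \<mu>: "\<mu> \<in> E" "\<theta> ! j = arccos (sqrt \<mu>)" using E(1) by (metis imageE nth_mem)
    then show "\<bar>sin (\<theta> ! j)\<bar> \<le> sin (\<theta> ! i)" using E(2,3) by (auto simp: \<theta>i sin_E)
  qed
  then show "mat_norm2 (sin_Theta n X Y) = s / sqrt (1 + s\<^sup>2)"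
    using sin_E[OF E(2)] by (simp add: sin_Theta_def Let_def \<theta>i sin_c flip: \<theta>_def)
  have "mat_norm2 (mat_diag (length \<theta>) (\<lambda>i. tan (\<theta> ! i))) = tan (\<theta> ! i)"
  proof (rule mat_norm2_mat_diag[OF i])
    fix j assume "j < length \<theta>"
    then obtain \<mu> where \<mu>: "\<mu> \<in> E" "\<theta> ! j = arccos (sqrt \<mu>)" using E(1) by (metis imageE nth_mem)
    then have "sqrt (1 - \<mu>) / sqrt \<mu> \<le> sqrt (1 - c) / sqrt c"
      using E(2,3) c by (intro frac_le) auto
    then show "\<bar>tan (\<theta> ! j)\<bar> \<le> tan (\<theta> ! i)"
      using \<mu> E(2,3) c by (auto simp: \<theta>i tan_E)
  qed
  then show "mat_norm2 (tan_Theta n X Y) = s"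
    using tan_E[OF E(2)] by (simp add: tan_Theta_def Let_def \<theta>i tan_c flip: \<theta>_def)
qed

end

section \<open>Krylov spaces in singular coordinates\<close>
lemma mat_inverse_eq_Some:
  fixes A B :: "real mat"
  assumes A: "A \<in> carrier_mat k k" and B: "B \<in> carrier_mat k k" and AB: "A * B = 1\<^sub>m k"
  shows "mat_inverse A = Some B"
proof (cases "mat_inverse A")
  case None
  have BA: "B * A = 1\<^sub>m k" by (rule mat_mult_left_right_inverse[OF A B AB])
  have "A \<in> Units (ring_mat TYPE(real) k ())"
    using A B AB BA unfolding Units_def by (auto simp: ring_mat_simps)
  with mat_inverse(1)[OF A None, of "()"] show ?thesis by blast
next
  case (Some B')
  then have B': "B' * A = 1\<^sub>m k" "B' \<in> carrier_mat k k" using mat_inverse(2)[OF A] by auto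
  have "B' = B' * (A * B)" using AB B' by simp
  also have "\<dots> = (B' * A) * B" using A B B'(2) by (intro assoc_mult_mat[symmetric]) auto
  finally show ?thesis using Some B' B by simp
qed

text \<open>
  The Lagrange basis polynomial for the nodes \<open>\<sigma> 1 ^ 2, \<dots>, \<sigma> k ^ 2\<close>, as an element of
  the polynomial type because its coefficients are needed: they form the columns of the inverse
  of the Vandermonde matrix.
\<close>
definition lagrange_poly :: "(nat \<Rightarrow> real) \<Rightarrow> nat \<Rightarrow> nat \<Rightarrow> real poly" where
  "lagrange_poly \<sigma> k j =
     (\<Prod>i\<in>{1..k} - {j}. [: - (\<sigma> i)\<^sup>2 / ((\<sigma> j)\<^sup>2 - (\<sigma> i)\<^sup>2), 1 / ((\<sigma> j)\<^sup>2 - (\<sigma> i)\<^sup>2) :])"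

lemma poly_lagrange_poly:
  "poly (lagrange_poly \<sigma> k j) x =
     (\<Prod>i\<in>{1..k} - {j}. (x - (\<sigma> i)\<^sup>2) / ((\<sigma> j)\<^sup>2 - (\<sigma> i)\<^sup>2))"
  unfolding lagrange_poly_def poly_prod by (intro prod.cong) (auto simp: diff_divide_distrib)

lemma poly_lagrange_poly_node:
  assumes inj: "inj_on (\<lambda>i. (\<sigma> i)\<^sup>2) {1..k}" and ij: "i \<in> {1..k}" "j \<in> {1..k}"
  shows "poly (lagrange_poly \<sigma> k j) ((\<sigma> i)\<^sup>2) = (if i = j then 1 else 0)"
proof (cases "i = j")
  case True
  have "(\<sigma> j)\<^sup>2 \<noteq> (\<sigma> l)\<^sup>2" if "l \<in> {1..k} - {j}" for l
    using inj_onD[OF inj, of j l] that ij by auto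
  then have "poly (lagrange_poly \<sigma> k j) ((\<sigma> j)\<^sup>2) = (\<Prod>l\<in>{1..k} - {j}. 1)"
    unfolding poly_lagrange_poly by (intro prod.cong) auto
  then show ?thesis using True by simp
next
  case False
  then show ?thesis using ij by (auto simp: poly_lagrange_poly)
qed

lemma degree_lagrange_poly:
  assumes "j \<in> {1..k}"
  shows "degree (lagrange_poly \<sigma> k j) < k"
proof -
  have "degree (lagrange_poly \<sigma> k j) \<le> (\<Sum>i\<in>{1..k} - {j}. 1)"
    unfolding lagrange_poly_def
    by (rule order_trans[OF degree_prod_sum_le sum_mono]) auto
  also have "\<dots> = k - 1" using assms by simp
  finally show ?thesis using assms by auto
qed

lemma poly_eq_sum_lessThan:
  fixes p :: "real poly"
  assumes "degree p < k"
  shows "poly p x = (\<Sum>l<k. coeff p l * x ^ l)"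
proof -
  have "poly p x = (\<Sum>l\<le>degree p. coeff p l * x ^ l)" by (rule poly_altdef)
  also have "\<dots> = (\<Sum>l<k. coeff p l * x ^ l)"
    using assms by (intro sum.mono_neutral_left) (auto simp: coeff_eq_0)
  finally show ?thesis .
qed

text \<open>
  To the left of all nodes each factor \<open>\<bar>x - (\<sigma> i)\<^sup>2\<bar>\<close> grows as \<open>x\<close> moves down to 0.
\<close>
lemma abs_lagrange_poly_le:
  assumes pos: "\<And>l. l \<in> {1..k} \<Longrightarrow> x \<le> (\<sigma> l)\<^sup>2" and x: "0 \<le> x"
  shows "\<bar>poly (lagrange_poly \<sigma> k j) x\<bar> \<le> lagrange0 \<sigma> k j"
proof -
  have "\<bar>poly (lagrange_poly \<sigma> k j) x\<bar> =
      (\<Prod>i\<in>{1..k} - {j}. \<bar>x - (\<sigma> i)\<^sup>2\<bar> / \<bar>(\<sigma> j)\<^sup>2 - (\<sigma> i)\<^sup>2\<bar>)"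
    by (simp add: poly_lagrange_poly abs_prod)
  also have "\<dots> \<le> lagrange0 \<sigma> k j"
  proof -
    have "\<bar>x - (\<sigma> i)\<^sup>2\<bar> \<le> (\<sigma> i)\<^sup>2" if "i \<in> {1..k} - {j}" for i
      using pos[of i] x that by auto
    then show ?thesis
      unfolding lagrange0_def by (intro prod_mono conjI divide_right_mono) auto
  qed
  finally show ?thesis .
qed

text \<open>
  Multiplying by the coefficient matrix evaluates the basis polynomials at the points
  \<open>(g i)\<^sup>2\<close>. At the nodes the result is the identity, at the remaining squared
  singular values it gives the entries of the product of the lower Vandermonde block with the inverse
  of the upper one.
\<close>
lemma vandermonde_mult_lagrange:
  "mat r k (\<lambda>(i, j). g i ^ (2 * j)) *
      mat k k (\<lambda>(l, j). coeff (lagrange_poly \<sigma> k (j + 1)) l) =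
    mat r k (\<lambda>(i, j). poly (lagrange_poly \<sigma> k (j + 1)) ((g i)\<^sup>2))"
proof (rule eq_matI)
  fix i j assume "i < dim_row (mat r k (\<lambda>(i, j). poly (lagrange_poly \<sigma> k (j + 1)) ((g i)\<^sup>2)))"
    "j < dim_col (mat r k (\<lambda>(i, j). poly (lagrange_poly \<sigma> k (j + 1)) ((g i)\<^sup>2)))"
  then have "i < r" "j < k" by auto
  have "poly (lagrange_poly \<sigma> k (j + 1)) ((g i)\<^sup>2) =
      (\<Sum>l<k. coeff (lagrange_poly \<sigma> k (j + 1)) l * ((g i)\<^sup>2) ^ l)"
    using \<open>j < k\<close> by (intro poly_eq_sum_lessThan degree_lagrange_poly) auto
  also have "\<dots> = (\<Sum>l<k. g i ^ (2 * l) * coeff (lagrange_poly \<sigma> k (j + 1)) l)"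
    by (intro sum.cong refl) (metis power_mult mult.commute)
  finally show "(mat r k (\<lambda>(i, j). g i ^ (2 * j)) *
      mat k k (\<lambda>(l, j). coeff (lagrange_poly \<sigma> k (j + 1)) l)) $$ (i, j) =
    mat r k (\<lambda>(i, j). poly (lagrange_poly \<sigma> k (j + 1)) ((g i)\<^sup>2)) $$ (i, j)"
    using \<open>i < r\<close> \<open>j < k\<close> by (simp add: scalar_prod_def atLeast0LessThan)
qed auto

lemma mult_split_cols:
  fixes V M :: "real mat"
  assumes "V \<in> carrier_mat r n" "M \<in> carrier_mat n c" "k \<le> n"
  shows "V * M = mat r k (\<lambda>(i, j). V $$ (i, j)) * mat k c (\<lambda>(i, j). M $$ (i, j)) +
    mat r (n - k) (\<lambda>(i, j). V $$ (i, j + k)) * mat (n - k) c (\<lambda>(i, j). M $$ (i + k, j))"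
    (is "_ = ?V1 * ?M1 + ?V2 * ?M2")
proof (rule eq_matI)
  fix i j assume "i < dim_row (?V1 * ?M1 + ?V2 * ?M2)" "j < dim_col (?V1 * ?M1 + ?V2 * ?M2)"
  then have ij: "i < r" "j < c" by auto
  have "(V * M) $$ (i, j) = (\<Sum>l<n. V $$ (i, l) * M $$ (l, j))"
    using assms ij by (simp add: scalar_prod_def atLeast0LessThan)
  also have "\<dots> = (\<Sum>l<k. V $$ (i, l) * M $$ (l, j)) + (\<Sum>l=k..<n. V $$ (i, l) * M $$ (l, j))"
    using assms(3) by (simp add: sum.atLeastLessThan_concat flip: atLeast0LessThan)
  also have "(\<Sum>l=k..<n. V $$ (i, l) * M $$ (l, j)) = (\<Sum>l<n - k. V $$ (i, l + k) * M $$ (l + k, j))"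
    using sum.shift_bounds_nat_ivl[of "\<lambda>l. V $$ (i, l) * M $$ (l, j)" 0 k "n - k"] assms(3)
    by (simp add: atLeast0LessThan)
  finally show "(V * M) $$ (i, j) = (?V1 * ?M1 + ?V2 * ?M2) $$ (i, j)"
    using ij by (simp add: scalar_prod_def atLeast0LessThan)
qed (use assms in auto)

lemma col_space_mult_invertible:
  fixes W S S' :: "real mat"
  assumes W: "W \<in> carrier_mat n k" and S: "S \<in> carrier_mat k k" and S': "S' \<in> carrier_mat k k"
    and SS': "S * S' = 1\<^sub>m k"
  shows "vec_space.col_space n (W * S) = vec_space.col_space n W"
proof -
  have WS: "W * S \<in> carrier_mat n k" using W S by auto
  have "(\<exists>x\<in>carrier_vec k. (W * S) *\<^sub>v x = w) \<longleftrightarrow> (\<exists>x\<in>carrier_vec k. W *\<^sub>v x = w)" for w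
  proof
    assume "\<exists>x\<in>carrier_vec k. (W * S) *\<^sub>v x = w"
    then obtain x where x: "x \<in> carrier_vec k" "(W * S) *\<^sub>v x = w" by blast
    then have "W *\<^sub>v (S *\<^sub>v x) = w" "S *\<^sub>v x \<in> carrier_vec k"
      using W S by (auto simp: assoc_mult_mat_vec[of _ n k _ k])
    then show "\<exists>x\<in>carrier_vec k. W *\<^sub>v x = w" by blast
  next
    assume "\<exists>x\<in>carrier_vec k. W *\<^sub>v x = w"
    then obtain x where x: "x \<in> carrier_vec k" "W *\<^sub>v x = w" by blast
    have S'x: "S' *\<^sub>v x \<in> carrier_vec k" using S' x by auto
    have "(W * S) *\<^sub>v (S' *\<^sub>v x) = W *\<^sub>v (S *\<^sub>v (S' *\<^sub>v x))"
      using W S S'x by (rule assoc_mult_mat_vec)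
    also have "S *\<^sub>v (S' *\<^sub>v x) = (S * S') *\<^sub>v x"
      using S S' x(1) by (rule assoc_mult_mat_vec[symmetric])
    also have "\<dots> = x" using x(1) by (simp add: SS')
    finally show "\<exists>x\<in>carrier_vec k. (W * S) *\<^sub>v x = w" using S'x x(2) by blast
  qed
  then show ?thesis using mem_col_space_iff[OF W] mem_col_space_iff[OF WS] by blast
qed

text \<open>
  With \<open>M1\<close> and \<open>M2\<close> the upper and lower block of the coordinate matrix of the Krylov
  vectors, \<open>Delta\<close> is the quotient of \<open>M2\<close> by \<open>M1\<close>. This is what makes the
  Krylov space the graph of \<open>Delta\<close>; the explicit entries are for the norm estimate.
\<close>
lemma Delta_eq:
  fixes U :: "real mat" and b :: "real vec" and \<sigma> :: "nat \<Rightarrow> real"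
    and n k :: nat
  defines "d \<equiv> \<lambda>i. \<sigma> (i + 1) * (col U i \<bullet> b)"
  defines "M1 \<equiv> mat k k (\<lambda>(i, j). d i * \<sigma> (i + 1) ^ (2 * j))"
  defines "M2 \<equiv> mat (n - k) k (\<lambda>(i, j). d (i + k) * \<sigma> (i + k + 1) ^ (2 * j))"
  assumes k: "k \<le> n" and inj: "inj_on (\<lambda>i. (\<sigma> i)\<^sup>2) {1..k}"
    and nz: "\<And>i. i < k \<Longrightarrow> d i \<noteq> 0"
  shows Delta_entries: "Delta n U \<sigma> b k = mat (n - k) k
      (\<lambda>(i, j). d (i + k) * poly (lagrange_poly \<sigma> k (j + 1)) ((\<sigma> (i + k + 1))\<^sup>2) / d j)"
    and Delta_mult_leading_block: "Delta n U \<sigma> b k * M1 = M2"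
    and leading_block_invertible: "\<exists>M1'\<in>carrier_mat k k. M1 * M1' = 1\<^sub>m k"
proof -
  define D1 where "D1 = mat_diag k d"
  define D1' where "D1' = mat_diag k (\<lambda>i. 1 / d i)"
  define D2 where "D2 = mat_diag (n - k) (\<lambda>i. d (i + k))"
  define T1 where "T1 = mat k k (\<lambda>(i, j). \<sigma> (i + 1) ^ (2 * j))"
  define T2 where "T2 = mat (n - k) k (\<lambda>(i, j). \<sigma> (i + k + 1) ^ (2 * j))"
  define C where "C = mat k k (\<lambda>(l, j). coeff (lagrange_poly \<sigma> k (j + 1)) l)"
  have carriers: "D1 \<in> carrier_mat k k" "D1' \<in> carrier_mat k k" "D2 \<in> carrier_mat (n - k) (n - k)"
    "T1 \<in> carrier_mat k k" "T2 \<in> carrier_mat (n - k) k" "C \<in> carrier_mat k k"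
    by (auto simp: D1_def D1'_def D2_def T1_def T2_def C_def)
  have D1D1': "D1 * D1' = 1\<^sub>m k" "D1' * D1 = 1\<^sub>m k"
    unfolding D1_def D1'_def mat_diag_diag using nz by (auto simp: mat_diag_def intro!: eq_matI)
  have T1C: "T1 * C = 1\<^sub>m k"
  proof (rule eq_matI)
    fix i j assume "i < dim_row (1\<^sub>m k)" "j < dim_col (1\<^sub>m k)"
    then have ij: "i < k" "j < k" by auto
    then have "(T1 * C) $$ (i, j) = poly (lagrange_poly \<sigma> k (j + 1)) ((\<sigma> (i + 1))\<^sup>2)"
      unfolding T1_def C_def vandermonde_mult_lagrange by simp
    also have "\<dots> = (if i + 1 = j + 1 then 1 else 0)"
      using ij by (intro poly_lagrange_poly_node[OF inj]) auto
    finally show "(T1 * C) $$ (i, j) = 1\<^sub>m k $$ (i, j)" using ij by simp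
  qed (auto simp: T1_def C_def)
  have CT1: "C * T1 = 1\<^sub>m k"
    using mat_mult_left_right_inverse[OF carriers(4,6) T1C] .
  have splitD: "split_block (mat_diag n d) k k = (D1, 0\<^sub>m k (n - k), 0\<^sub>m (n - k) k, D2)"
    using k by (auto simp: split_block_def Let_def mat_diag_def D1_def D2_def intro!: eq_matI)
  \<comment> \<open>The Vandermonde matrix has \<open>k\<close> columns, so its two right-hand blocks are empty.\<close>
  have splitT: "split_block (mat n k (\<lambda>(i, j). \<sigma> (i + 1) ^ (2 * j))) k k =
      (T1, mat k 0 undefined, T2, mat (n - k) 0 undefined)"
    using k by (auto simp: split_block_def Let_def T1_def T2_def intro!: eq_matI)
  have \<Delta>: "Delta n U \<sigma> b k = D2 * T2 * C * D1'"
    unfolding Delta_def Let_def d_def[symmetric] splitD splitT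
    using mat_inverse_eq_Some[OF carriers(4,6) T1C] mat_inverse_eq_Some[OF carriers(1,2) D1D1'(1)]
    by simp
  have M1: "M1 = D1 * T1"
    unfolding M1_def D1_def T1_def by (subst mat_diag_mult_left[of _ _ k]) (auto intro!: eq_matI)
  have M2: "M2 = D2 * T2"
    unfolding M2_def D2_def T2_def by (subst mat_diag_mult_left[of _ _ k]) (auto intro!: eq_matI)
  have "D2 * T2 * C = D2 * (T2 * C)"
    using carriers by (intro assoc_mult_mat[of _ "n - k" "n - k" _ k]) auto
  also have "T2 * C = mat (n - k) k
      (\<lambda>(i, j). poly (lagrange_poly \<sigma> k (j + 1)) ((\<sigma> (i + k + 1))\<^sup>2))"
    unfolding T2_def C_def by (rule vandermonde_mult_lagrange)
  also have "D2 * \<dots> = mat (n - k) k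
      (\<lambda>(i, j). d (i + k) * poly (lagrange_poly \<sigma> k (j + 1)) ((\<sigma> (i + k + 1))\<^sup>2))"
    unfolding D2_def by (subst mat_diag_mult_left[of _ _ k]) (auto intro!: eq_matI)
  finally have "Delta n U \<sigma> b k = mat (n - k) k
      (\<lambda>(i, j). d (i + k) * poly (lagrange_poly \<sigma> k (j + 1)) ((\<sigma> (i + k + 1))\<^sup>2)) * D1'"
    by (simp add: \<Delta>)
  also have "\<dots> = mat (n - k) k
      (\<lambda>(i, j). d (i + k) * poly (lagrange_poly \<sigma> k (j + 1)) ((\<sigma> (i + k + 1))\<^sup>2) / d j)"
    unfolding D1'_def by (subst mat_diag_mult_right[of _ "n - k"]) (auto intro!: eq_matI)
  finally show "Delta n U \<sigma> b k = \<dots>" .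
  have M1_inv: "(C * D1') * (D1 * T1) = 1\<^sub>m k" "(D1 * T1) * (C * D1') = 1\<^sub>m k"
  proof -
    have "(C * D1') * (D1 * T1) = C * (D1' * (D1 * T1))"
      using carriers by (intro assoc_mult_mat[of _ k k _ k]) auto
    also have "D1' * (D1 * T1) = (D1' * D1) * T1"
      using carriers by (intro assoc_mult_mat[symmetric, of _ k k _ k]) auto
    finally show left: "(C * D1') * (D1 * T1) = 1\<^sub>m k" using carriers by (simp add: D1D1' CT1)
    show "(D1 * T1) * (C * D1') = 1\<^sub>m k"
      using carriers by (intro mat_mult_left_right_inverse[OF _ _ left]) auto
  qed
  have "Delta n U \<sigma> b k * M1 = (D2 * T2 * (C * D1')) * (D1 * T1)"
    unfolding \<Delta> M1 using carriers by (subst assoc_mult_mat[of _ "n - k" k _ k]) auto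
  also have "\<dots> = D2 * T2 * ((C * D1') * (D1 * T1))"
    using carriers by (intro assoc_mult_mat[of _ "n - k" k _ k]) auto
  finally show "Delta n U \<sigma> b k * M1 = M2"
    using carriers by (simp add: M1_inv M2)
  show "\<exists>M1'\<in>carrier_mat k k. M1 * M1' = 1\<^sub>m k"
    unfolding M1 using M1_inv(2) carriers by (intro bexI[of _ "C * D1'"]) auto
qed

context
  fixes m n :: nat and A U V :: "real mat" and \<sigma> :: "nat \<Rightarrow> real"
  assumes nm: "n \<le> m" and svd: "is_svd m n A U \<sigma> V"
begin

lemma A_carrier: "A \<in> carrier_mat m n"
  using svd unfolding is_svd_def by blast

lemma V_carrier: "V \<in> carrier_mat n n" and V_V: "V\<^sup>T * V = 1\<^sub>m n" and U_carrier: "U \<in> carrier_mat m m"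
  using svd by (auto simp: is_svd_def)

text \<open>
  The orthogonal factor \<open>U\<close> cancels, so a Krylov step only multiplies the coordinates with respect
  to the right singular vectors by the squared singular values.
\<close>
lemma svd_Gram: "A\<^sup>T * A = V * mat_diag n (\<lambda>i. (\<sigma> (i + 1))\<^sup>2) * V\<^sup>T" (is ?Gram)
  and svd_adjoint_mult_vec: "b \<in> carrier_vec m \<Longrightarrow>
    A\<^sup>T *\<^sub>v b = V *\<^sub>v vec n (\<lambda>i. \<sigma> (i + 1) * (col U i \<bullet> b))"
proof -
  define S where "S = mat m n (\<lambda>(i, j). if i = j then \<sigma> (j + 1) else 0)"
  have S: "S \<in> carrier_mat m n" by (simp add: S_def)
  have "mat_diag n (\<lambda>i. \<sigma> (i + 1)) @\<^sub>r 0\<^sub>m (m - n) n = S"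
    using nm by (intro eq_matI) (auto simp: S_def append_rows_def mat_diag_def)
  then have A: "A = U * S * V\<^sup>T" and U_U: "U\<^sup>T * U = 1\<^sub>m m"
    using svd by (auto simp: is_svd_def)
  have US: "U * S \<in> carrier_mat m n" using U_carrier S by auto
  have "A\<^sup>T = V * (U * S)\<^sup>T"
    unfolding A using US V_carrier by (simp add: transpose_mult[of _ m n])
  also have "(U * S)\<^sup>T = S\<^sup>T * U\<^sup>T" using U_carrier S by (rule transpose_mult)
  finally have AT: "A\<^sup>T = V * (S\<^sup>T * U\<^sup>T)" .
  have SS: "S\<^sup>T * S = mat_diag n (\<lambda>i. (\<sigma> (i + 1))\<^sup>2)"
  proof (rule eq_matI)
    fix i j assume "i < dim_row (mat_diag n (\<lambda>i. (\<sigma> (i + 1))\<^sup>2))"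
      "j < dim_col (mat_diag n (\<lambda>i. (\<sigma> (i + 1))\<^sup>2))"
    then have ij: "i < n" "j < n" by (auto simp: mat_diag_def)
    then have "(S\<^sup>T * S) $$ (i, j) = (\<Sum>l<m. S $$ (l, i) * S $$ (l, j))"
      using S by (simp add: scalar_prod_def atLeast0LessThan)
    also have "\<dots> = (\<Sum>l<m. if l = i then (if i = j then (\<sigma> (i + 1))\<^sup>2 else 0) else 0)"
      using ij by (intro sum.cong) (auto simp: S_def power2_eq_square)
    also have "\<dots> = (if i = j then (\<sigma> (i + 1))\<^sup>2 else 0)"
      using ij nm by simp
    finally show "(S\<^sup>T * S) $$ (i, j) = mat_diag n (\<lambda>i. (\<sigma> (i + 1))\<^sup>2) $$ (i, j)"
      using ij by (simp add: mat_diag_def)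
  qed (auto simp: S_def mat_diag_def)
  have "A\<^sup>T * A = V * (S\<^sup>T * U\<^sup>T) * (U * S) * V\<^sup>T"
    unfolding AT unfolding A using V_carrier U_carrier S
    by (intro assoc_mult_mat[symmetric, of _ n m _ n]) auto
  also have "V * (S\<^sup>T * U\<^sup>T) * (U * S) = V * ((S\<^sup>T * U\<^sup>T) * (U * S))"
    using V_carrier U_carrier S by (intro assoc_mult_mat[of _ n n _ m]) auto
  also have "(S\<^sup>T * U\<^sup>T) * (U * S) = S\<^sup>T * (U\<^sup>T * (U * S))"
    using U_carrier S by (intro assoc_mult_mat[of _ n m _ m]) auto
  also have "U\<^sup>T * (U * S) = (U\<^sup>T * U) * S"
    using U_carrier S by (intro assoc_mult_mat[symmetric, of _ m m _ m]) auto
  finally show ?Gram using S by (simp add: U_U SS)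
  assume b: "b \<in> carrier_vec m"
  have "A\<^sup>T *\<^sub>v b = V *\<^sub>v ((S\<^sup>T * U\<^sup>T) *\<^sub>v b)"
    unfolding AT using V_carrier U_carrier S b by (intro assoc_mult_mat_vec) auto
  also have "(S\<^sup>T * U\<^sup>T) *\<^sub>v b = S\<^sup>T *\<^sub>v (U\<^sup>T *\<^sub>v b)"
    using U_carrier S b by (intro assoc_mult_mat_vec) auto
  also have "\<dots> = vec n (\<lambda>i. \<sigma> (i + 1) * (col U i \<bullet> b))"
  proof (rule eq_vecI)
    fix i assume "i < dim_vec (vec n (\<lambda>i. \<sigma> (i + 1) * (col U i \<bullet> b)))"
    then have i: "i < n" by simp
    then have "(S\<^sup>T *\<^sub>v (U\<^sup>T *\<^sub>v b)) $ i = (\<Sum>l<m. S $$ (l, i) * (col U l \<bullet> b))"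
      using S U_carrier by (simp add: scalar_prod_def[of "row _ _" "_ *\<^sub>v _"] atLeast0LessThan
          scalar_prod_def[of "col S i"])
    also have "\<dots> = (\<Sum>l<m. if l = i then \<sigma> (i + 1) * (col U i \<bullet> b) else 0)"
      using i by (intro sum.cong) (auto simp: S_def)
    finally show "(S\<^sup>T *\<^sub>v (U\<^sup>T *\<^sub>v b)) $ i = vec n (\<lambda>i. \<sigma> (i + 1) * (col U i \<bullet> b)) $ i"
      using i nm by simp
  qed (use S in auto)
  finally show "A\<^sup>T *\<^sub>v b = V *\<^sub>v vec n (\<lambda>i. \<sigma> (i + 1) * (col U i \<bullet> b))" .
qed

lemma svd_Gram_power_mult_vec:
  assumes "w \<in> carrier_vec n"
  shows "((A\<^sup>T * A) ^\<^sub>m j) *\<^sub>v (V *\<^sub>v w) = V *\<^sub>v vec n (\<lambda>i. \<sigma> (i + 1) ^ (2 * j) * w $ i)"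
  using assms
proof (induction j arbitrary: w)
  case 0
  have "vec n (\<lambda>i. \<sigma> (i + 1) ^ (2 * 0) * w $ i) = w" using 0 by (intro eq_vecI) auto
  then show ?case using A_carrier V_carrier 0 by simp
next
  case (Suc j)
  define D where "D = mat_diag n (\<lambda>i. (\<sigma> (i + 1))\<^sup>2)"
  have D: "D \<in> carrier_mat n n" by (simp add: D_def)
  have AA: "A\<^sup>T * A \<in> carrier_mat n n" using A_carrier by auto
  have Vw: "V *\<^sub>v w \<in> carrier_vec n" using V_carrier Suc.prems by auto
  define w' where "w' = vec n (\<lambda>i. (\<sigma> (i + 1))\<^sup>2 * w $ i)"
  have Dw: "D *\<^sub>v w = w'"
  proof (rule eq_vecI)
    fix i assume "i < dim_vec w'"
    then have i: "i < n" by (simp add: w'_def)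
    have "(D *\<^sub>v w) $ i = (\<Sum>l<n. (if i = l then (\<sigma> (Suc l))\<^sup>2 else 0) * w $ l)"
      using i Suc.prems by (simp add: D_def mat_diag_def scalar_prod_def atLeast0LessThan)
    also have "\<dots> = (\<Sum>l<n. if l = i then (\<sigma> (i + 1))\<^sup>2 * w $ i else 0)"
      by (intro sum.cong) auto
    finally have "(D *\<^sub>v w) $ i = (\<Sum>l<n. if l = i then (\<sigma> (i + 1))\<^sup>2 * w $ i else 0)" .
    then show "(D *\<^sub>v w) $ i = w' $ i" using i by (simp add: w'_def)
  qed (auto simp: D_def w'_def mat_diag_def)
  have "(A\<^sup>T * A) *\<^sub>v (V *\<^sub>v w) = (V * D) *\<^sub>v (V\<^sup>T *\<^sub>v (V *\<^sub>v w))"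
    unfolding svd_Gram D_def[symmetric] using V_carrier D Vw by (intro assoc_mult_mat_vec) auto
  also have "V\<^sup>T *\<^sub>v (V *\<^sub>v w) = w"
    using V_carrier Suc.prems by (simp add: V_V flip: assoc_mult_mat_vec[of _ n n])
  also have "(V * D) *\<^sub>v w = V *\<^sub>v w'"
    using V_carrier D Suc.prems by (simp add: assoc_mult_mat_vec[of _ n n _ n] Dw)
  finally have step: "(A\<^sup>T * A) *\<^sub>v (V *\<^sub>v w) = V *\<^sub>v w'" .
  have "((A\<^sup>T * A) ^\<^sub>m Suc j) *\<^sub>v (V *\<^sub>v w) = ((A\<^sup>T * A) ^\<^sub>m j) *\<^sub>v ((A\<^sup>T * A) *\<^sub>v (V *\<^sub>v w))"
    unfolding pow_mat.simps using pow_carrier_mat[OF AA] AA Vw by (rule assoc_mult_mat_vec)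
  also have "\<dots> = V *\<^sub>v vec n (\<lambda>i. \<sigma> (i + 1) ^ (2 * j) * w' $ i)"
    unfolding step by (rule Suc.IH) (simp add: w'_def)
  also have "vec n (\<lambda>i. \<sigma> (i + 1) ^ (2 * j) * w' $ i) =
      vec n (\<lambda>i. \<sigma> (i + 1) ^ (2 * Suc j) * w $ i)"
    by (intro eq_vecI) (auto simp: w'_def power2_eq_square mult.assoc)
  finally show ?case .
qed

lemma krylov_space_eq_col_space:
  assumes b: "b \<in> carrier_vec m"
  shows "krylov_space n (A\<^sup>T * A) (A\<^sup>T *\<^sub>v b) k = vec_space.col_space n
    (V * mat n k (\<lambda>(i, j). \<sigma> (i + 1) * (col U i \<bullet> b) * \<sigma> (i + 1) ^ (2 * j)))"
proof -
  define K where "K = mat n k (\<lambda>(i, j). \<sigma> (i + 1) * (col U i \<bullet> b) * \<sigma> (i + 1) ^ (2 * j))"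
  have coords: "vec n (\<lambda>i. \<sigma> (i + 1) ^ (2 * j) * vec n (\<lambda>i. \<sigma> (i + 1) * (col U i \<bullet> b)) $ i) = col K j"
    if "j < k" for j
    using that by (intro eq_vecI) (auto simp: K_def)
  have vector: "((A\<^sup>T * A) ^\<^sub>m j) *\<^sub>v (A\<^sup>T *\<^sub>v b) = col (V * K) j" if "j < k" for j
  proof -
    have "((A\<^sup>T * A) ^\<^sub>m j) *\<^sub>v (A\<^sup>T *\<^sub>v b) = V *\<^sub>v col K j"
      unfolding svd_adjoint_mult_vec[OF b] coords[OF that, symmetric]
      by (rule svd_Gram_power_mult_vec) simp
    also have "\<dots> = col (V * K) j"
      using that V_carrier by (intro eq_vecI) (auto simp: K_def)
    finally show ?thesis .
  qed
  have "{((A\<^sup>T * A) ^\<^sub>m i) *\<^sub>v (A\<^sup>T *\<^sub>v b) |i. i < k} =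
      (\<lambda>i. ((A\<^sup>T * A) ^\<^sub>m i) *\<^sub>v (A\<^sup>T *\<^sub>v b)) ` {..<k}" by auto
  also have "\<dots> = col (V * K) ` {..<k}" by (intro image_cong refl vector) auto
  also have "\<dots> = set (cols (V * K))"
    by (auto simp: cols_def K_def)
  finally show ?thesis
    unfolding krylov_space_def vec_space.col_space_def K_def by simp
qed

lemma krylov_space_eq_graph:
  assumes b: "b \<in> carrier_vec m" and k: "k \<le> n" and inj: "inj_on (\<lambda>i. (\<sigma> i)\<^sup>2) {1..k}"
    and nz: "\<And>i. i < k \<Longrightarrow> \<sigma> (i + 1) * (col U i \<bullet> b) \<noteq> 0"
  shows "krylov_space n (A\<^sup>T * A) (A\<^sup>T *\<^sub>v b) k = vec_space.col_space n
    (mat n k (\<lambda>(i, j). V $$ (i, j)) +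
     mat n (n - k) (\<lambda>(i, j). V $$ (i, j + k)) * Delta n U \<sigma> b k)"
proof -
  define d where "d = (\<lambda>i. \<sigma> (i + 1) * (col U i \<bullet> b))"
  define \<Delta> where "\<Delta> = Delta n U \<sigma> b k"
  define V1 where "V1 = mat n k (\<lambda>(i, j). V $$ (i, j))"
  define V2 where "V2 = mat n (n - k) (\<lambda>(i, j). V $$ (i, j + k))"
  define K where "K = mat n k (\<lambda>(i, j). d i * \<sigma> (i + 1) ^ (2 * j))"
  define M1 where "M1 = mat k k (\<lambda>(i, j). d i * \<sigma> (i + 1) ^ (2 * j))"
  define M2 where "M2 = mat (n - k) k (\<lambda>(i, j). d (i + k) * \<sigma> (i + k + 1) ^ (2 * j))"
  note Delta_facts = Delta_eq[where n = n and k = k and U = U and \<sigma> = \<sigma> and b = b, OF k inj nz]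
  have V1: "V1 \<in> carrier_mat n k" and V2: "V2 \<in> carrier_mat n (n - k)"
    and M1: "M1 \<in> carrier_mat k k"
    by (simp_all add: V1_def V2_def M1_def)
  have \<Delta>: "\<Delta> \<in> carrier_mat (n - k) k" and \<Delta>M1: "\<Delta> * M1 = M2"
  proof -
    have "Delta n U \<sigma> b k = mat (n - k) k (\<lambda>(i, j). \<sigma> (i + k + 1) * (col U (i + k) \<bullet> b) *
      poly (lagrange_poly \<sigma> k (j + 1)) ((\<sigma> (i + k + 1))\<^sup>2) / (\<sigma> (j + 1) * (col U j \<bullet> b)))"
      by (rule Delta_facts(1))
    then show "\<Delta> \<in> carrier_mat (n - k) k" by (simp add: \<Delta>_def)
    show "\<Delta> * M1 = M2" using Delta_facts(2) by (simp add: \<Delta>_def M1_def M2_def d_def)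
  qed
  obtain M1' where M1': "M1' \<in> carrier_mat k k" "M1 * M1' = 1\<^sub>m k"
    using Delta_facts(3) unfolding M1_def d_def by blast
  have "mat k k (\<lambda>(i, j). K $$ (i, j)) = M1" "mat (n - k) k (\<lambda>(i, j). K $$ (i + k, j)) = M2"
    using k by (auto simp: K_def M1_def M2_def intro!: eq_matI)
  then have "V * K = V1 * M1 + V2 * M2"
    using mult_split_cols[OF V_carrier, of K k k] k by (simp add: K_def V1_def V2_def)
  also have "V2 * M2 = (V2 * \<Delta>) * M1"
    unfolding \<Delta>M1[symmetric] using V2 \<Delta> M1 by (rule assoc_mult_mat[symmetric])
  also have "V1 * M1 + (V2 * \<Delta>) * M1 = (V1 + V2 * \<Delta>) * M1"
    using V1 V2 \<Delta> M1 by (intro add_mult_distrib_mat[symmetric]) auto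
  finally have "V * K = (V1 + V2 * \<Delta>) * M1" .
  moreover have "V1 + V2 * \<Delta> \<in> carrier_mat n k" using V1 V2 \<Delta> by auto
  ultimately have "vec_space.col_space n (V * K) = vec_space.col_space n (V1 + V2 * \<Delta>)"
    using col_space_mult_invertible[OF _ M1 M1'] by simp
  then show ?thesis
    using krylov_space_eq_col_space[OF b, of k] by (simp add: K_def d_def V1_def V2_def \<Delta>_def)
qed

end

lemma graph_subspace_column_blocks:
  fixes V \<Delta> :: "real mat"
  assumes V: "V \<in> carrier_mat n n" "V\<^sup>T * V = 1\<^sub>m n" and k: "1 \<le> k" "k \<le> n"
    and \<Delta>: "\<Delta> \<in> carrier_mat (n - k) k"
  shows "graph_subspace n k (n - k) (mat n k (\<lambda>(i, j). V $$ (i, j)))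
    (mat n (n - k) (\<lambda>(i, j). V $$ (i, j + k))) \<Delta>"
proof -
  let ?V1 = "mat n k (\<lambda>(i, j). V $$ (i, j))" and ?V2 = "mat n (n - k) (\<lambda>(i, j). V $$ (i, j + k))"
  have col: "col V i \<bullet> col V j = (if i = j then 1 else 0)" if "i < n" "j < n" for i j
  proof -
    have "col V i \<bullet> col V j = (V\<^sup>T * V) $$ (i, j)" using that V(1) by simp
    also have "\<dots> = 1\<^sub>m n $$ (i, j)" by (simp only: V(2))
    finally show ?thesis using that by simp
  qed
  have V1: "col ?V1 j = col V j" if "j < k" for j
    using that V(1) k by (intro eq_vecI) auto
  have V2: "col ?V2 j = col V (j + k)" if "j < n - k" for j
    using that V(1) k by (intro eq_vecI) auto
  show ?thesis
    by unfold_locales (use k \<Delta> V1 V2 col in \<open>auto intro!: eq_matI\<close>)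
qed

lemma right_singular_space_eq_col_space:
  assumes "V \<in> carrier_mat n n" "k \<le> n"
  shows "right_singular_space n V k = vec_space.col_space n (mat n k (\<lambda>(i, j). V $$ (i, j)))"
proof -
  have "col (mat n k (\<lambda>(i, j). V $$ (i, j))) i = col V i" if "i < k" for i
    using that assms by (intro eq_vecI) auto
  then have "{col V i |i. i < k} = set (cols (mat n k (\<lambda>(i, j). V $$ (i, j))))"
    by (auto simp: cols_def)
  then show ?thesis by (simp add: right_singular_space_def vec_space.col_space_def)
qed

section \<open>Norm bounds\<close>

text \<open>
  The two step estimates compare one term of a power sum with the integral over an interval of
  length 1, written through the antiderivative; the mean value theorem gives them at once, and
  the sums of these bounds telescope.
\<close>
lemma powr_step_le_integral_decreasing:
  fixes x a :: real
  assumes x: "0 < x" and a: "1 < a"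
  shows "(x + 1) powr (- a) \<le> (x powr (1 - a) - (x + 1) powr (1 - a)) / (a - 1)"
proof -
  define f where "f = (\<lambda>t::real. - (t powr (1 - a)) / (a - 1))"
  have "\<exists>z>x. z < x + 1 \<and> f (x + 1) - f x = (x + 1 - x) * z powr (- a)"
  proof (rule MVT2)
    fix t assume "x \<le> t" "t \<le> x + 1"
    then have "((\<lambda>t. t powr (1 - a)) has_real_derivative (1 - a) * t powr (1 - a - 1)) (at t)"
      using x by (intro has_real_derivative_powr) auto
    from DERIV_cdivide[OF DERIV_minus[OF this], of "a - 1"]
    have "(f has_real_derivative - ((1 - a) * t powr (1 - a - 1)) / (a - 1)) (at t)"
      unfolding f_def .
    also have "- ((1 - a) * t powr (1 - a - 1)) / (a - 1) = (a - 1) * t powr (- a) / (a - 1)"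
      by (simp add: algebra_simps)
    finally show "(f has_real_derivative t powr (- a)) (at t)" using a by simp
  qed simp
  then obtain z where z: "x < z" "z < x + 1" "f (x + 1) - f x = z powr (- a)" by auto
  have "(x + 1) powr (- a) \<le> z powr (- a)"
    using x a z by (intro powr_mono2') auto
  also have "\<dots> = (x powr (1 - a) - (x + 1) powr (1 - a)) / (a - 1)"
    unfolding z(3)[symmetric] f_def by (simp add: diff_divide_distrib)
  finally show ?thesis .
qed

lemma powr_step_le_integral_increasing:
  fixes x a :: real
  assumes x: "0 < x" and a: "0 < a"
  shows "x powr a \<le> ((x + 1) powr (a + 1) - x powr (a + 1)) / (a + 1)"
proof -
  define f where "f = (\<lambda>t::real. t powr (a + 1) / (a + 1))"
  have "\<exists>z>x. z < x + 1 \<and> f (x + 1) - f x = (x + 1 - x) * z powr a"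
  proof (rule MVT2)
    fix t assume "x \<le> t" "t \<le> x + 1"
    then have "((\<lambda>t. t powr (a + 1)) has_real_derivative (a + 1) * t powr (a + 1 - 1)) (at t)"
      using x by (intro has_real_derivative_powr) auto
    from DERIV_cdivide[OF this, of "a + 1"]
    have "(f has_real_derivative (a + 1) * t powr (a + 1 - 1) / (a + 1)) (at t)"
      unfolding f_def .
    then show "(f has_real_derivative t powr a) (at t)" using a by simp
  qed simp
  then obtain z where z: "x < z" "z < x + 1" "f (x + 1) - f x = z powr a" by auto
  have "x powr a \<le> z powr a"
    using x a z by (intro powr_mono2) auto
  also have "\<dots> = ((x + 1) powr (a + 1) - x powr (a + 1)) / (a + 1)"
    unfolding z(3)[symmetric] f_def by (simp add: diff_divide_distrib)
  finally show ?thesis .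
qed

lemma sum_powr_tail_le:
  fixes a :: real
  assumes a: "1 < a" and k: "1 \<le> k" and "k \<le> n"
  shows "(\<Sum>i\<in>{k<..n}. real i powr (- a)) \<le> real k powr (1 - a) / (a - 1)"
proof -
  have "(\<Sum>i\<in>{k<..n}. real i powr (- a)) \<le> (real k powr (1 - a) - real n powr (1 - a)) / (a - 1)"
    using \<open>k \<le> n\<close>
  proof (induction n rule: dec_induct)
    case (step n)
    have "{k<..Suc n} = insert (Suc n) {k<..n}" using step.hyps by auto
    then have "(\<Sum>i\<in>{k<..Suc n}. real i powr (- a)) =
        (real n + 1) powr (- a) + (\<Sum>i\<in>{k<..n}. real i powr (- a))"
      by (simp add: add.commute)
    also have "\<dots> \<le> (real n powr (1 - a) - (real n + 1) powr (1 - a)) / (a - 1) +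
        (real k powr (1 - a) - real n powr (1 - a)) / (a - 1)"
      using step k a by (intro add_mono powr_step_le_integral_decreasing) auto
    also have "\<dots> = (real k powr (1 - a) - real (Suc n) powr (1 - a)) / (a - 1)"
      by (simp add: add.commute flip: add_divide_distrib)
    finally show ?case .
  qed simp
  also have "\<dots> \<le> real k powr (1 - a) / (a - 1)"
    using a by (intro divide_right_mono) auto
  finally show ?thesis .
qed

lemma sum_powr_head_le:
  fixes a :: real
  assumes a: "0 < a" and k: "1 \<le> k"
  shows "(\<Sum>j\<in>{1..k}. real j powr a) \<le> real k powr a + real k powr (a + 1) / (a + 1)"
proof -
  have "(\<Sum>j\<in>{1..<k}. real j powr a) \<le> real k powr (a + 1) / (a + 1)"
    using k
  proof (induction k rule: dec_induct)
    case base
    show ?case using a by simp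
  next
    case (step k)
    have "(\<Sum>j\<in>{1..<Suc k}. real j powr a) = real k powr a + (\<Sum>j\<in>{1..<k}. real j powr a)"
      using step.hyps by (simp add: sum.atLeastLessThan_Suc add.commute)
    also have "\<dots> \<le> ((real k + 1) powr (a + 1) - real k powr (a + 1)) / (a + 1) +
        real k powr (a + 1) / (a + 1)"
      using step a by (intro add_mono powr_step_le_integral_increasing) auto
    also have "\<dots> = real (Suc k) powr (a + 1) / (a + 1)"
      by (simp add: add.commute flip: add_divide_distrib)
    finally show ?case .
  qed
  moreover have "{1..k} = insert k {1..<k}" using k by auto
  ultimately show ?thesis by simp
qed

text \<open>
  The last term of the increasing sum is kept separate from the integral. It contributes the
  summand linear in \<open>k\<close>, the integral contributes the quadratic one.
\<close>
lemma sum_powr_product_le: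
  fixes \<alpha> :: real
  assumes \<alpha>: "1 / 2 < \<alpha>" and k: "1 \<le> k" "k \<le> n"
  shows "(\<Sum>i\<in>{k<..n}. real i powr (- 2 * \<alpha>)) * (\<Sum>j\<in>{1..k}. real j powr (2 * \<alpha>))
    \<le> (real k)\<^sup>2 / (4 * \<alpha>\<^sup>2 - 1) + real k / (2 * \<alpha> - 1)"
proof -
  let ?a = "2 * \<alpha>"
  have "(\<Sum>i\<in>{k<..n}. real i powr (- 2 * \<alpha>)) * (\<Sum>j\<in>{1..k}. real j powr ?a)
      \<le> (real k powr (1 - ?a) / (?a - 1)) * (real k powr ?a + real k powr (?a + 1) / (?a + 1))"
    using sum_powr_tail_le[of ?a k n] sum_powr_head_le[of ?a k] \<alpha> k
    by (intro mult_mono) (auto intro: sum_nonneg)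
  also have "\<dots> = real k powr (1 - ?a) * real k powr ?a / (?a - 1) +
      real k powr (1 - ?a) * real k powr (?a + 1) / ((?a - 1) * (?a + 1))"
    by (simp add: algebra_simps)
  also have "real k powr (1 - ?a) * real k powr ?a = real k"
    using k by (simp flip: powr_add)
  also have "real k powr (1 - ?a) * real k powr (?a + 1) = (real k)\<^sup>2"
    using k by (simp flip: powr_add)
  also have "(?a - 1) * (?a + 1) = 4 * \<alpha>\<^sup>2 - 1"
    by (simp add: power2_eq_square algebra_simps)
  finally show ?thesis by (simp add: add.commute)
qed

text \<open>
  For \<open>k = 1\<close> the second sum of the product is exactly 1, and the bound loses its
  quadratic summand.
\<close>
lemma sum_powr_tail_one:
  fixes \<alpha> :: real
  assumes \<alpha>: "1 / 2 < \<alpha>" and "1 \<le> n"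
  shows "(\<Sum>i\<in>{1<..n}. real i powr (- 2 * \<alpha>)) \<le> 1 / (2 * \<alpha> - 1)"
  using sum_powr_tail_le[of "2 * \<alpha>" 1 n] assms by simp

lemma lagrange0_max_nonneg:
  assumes "1 \<le> k"
  shows "0 \<le> lagrange0_max \<sigma> k"
proof -
  have "0 \<le> lagrange0 \<sigma> k 1" unfolding lagrange0_def by (intro prod_nonneg) auto
  also have "\<dots> \<le> lagrange0_max \<sigma> k"
    unfolding lagrange0_max_def using assms by (intro Max_ge) auto
  finally show ?thesis .
qed

text \<open>
  An entry of \<open>Delta\<close> is \<open>\<sigma> i / \<sigma> j\<close> times a ratio of the coefficients of \<open>b\<close> times a value
  of a Lagrange basis polynomial. The last two factors are bounded uniformly, by
  \<open>\<rho>\<close> and \<open>lagrange0_max \<sigma> k\<close>. What remains is of rank one, and its Frobenius norm is the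
  square root of a product of two power sums.
\<close>
lemma norm_Delta_le:
  fixes U :: "real mat" and b :: "real vec" and \<sigma> :: "nat \<Rightarrow> real" and \<alpha> \<rho> \<zeta> :: real
    and n k :: nat
  defines "c \<equiv> \<lambda>j. \<bar>col U (j - 1) \<bullet> b\<bar>"
  assumes k: "1 \<le> k" "k < n" and \<zeta>: "0 < \<zeta>" and \<alpha>: "0 < \<alpha>"
    and \<sigma>: "\<And>j. j \<in> {1..n} \<Longrightarrow> \<sigma> j = \<zeta> * real j powr (- \<alpha>)"
    and c: "\<And>j. j \<in> {1..k} \<Longrightarrow> 0 < c j" and \<rho>: "0 \<le> \<rho>"
    and ratio: "\<And>i j. i \<in> {k<..n} \<Longrightarrow> j \<in> {1..k} \<Longrightarrow> c i \<le> \<rho> * c j"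
    and \<Delta>: "Delta n U \<sigma> b k = mat (n - k) k (\<lambda>(i, j). \<sigma> (i + k + 1) * (col U (i + k) \<bullet> b) *
      poly (lagrange_poly \<sigma> k (j + 1)) ((\<sigma> (i + k + 1))\<^sup>2) / (\<sigma> (j + 1) * (col U j \<bullet> b)))"
  shows "mat_norm2 (Delta n U \<sigma> b k) \<le>
    \<rho> * sqrt ((\<Sum>i\<in>{k<..n}. real i powr (- 2 * \<alpha>)) * (\<Sum>j\<in>{1..k}. real j powr (2 * \<alpha>))) *
    lagrange0_max \<sigma> k"
proof -
  define L where "L = lagrange0_max \<sigma> k"
  define x where "x = (\<lambda>i. real i powr (- 2 * \<alpha>))"
  define y where "y = (\<lambda>j. real j powr (2 * \<alpha>))"
  have L_upper: "lagrange0 \<sigma> k j \<le> L" if "j \<in> {1..k}" for j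
    unfolding L_def lagrange0_max_def using that by (intro Max_ge) auto
  have L: "0 \<le> L" using lagrange0_max_nonneg[OF k(1)] by (simp add: L_def)
  have pos: "0 < \<sigma> j" if "j \<in> {1..n}" for j using \<sigma>[OF that] \<zeta> that by simp
  have anti: "\<sigma> i \<le> \<sigma> j" if "i \<in> {1..n}" "j \<in> {1..n}" "j \<le> i" for i j
    using that \<zeta> \<alpha> by (simp add: \<sigma> powr_mono2')
  have entry: "(Delta n U \<sigma> b k $$ (i, j))\<^sup>2 \<le> (\<rho> * L)\<^sup>2 * (x (i + k + 1) * y (j + 1))"
    if ij: "i < n - k" "j < k" for i j
  proof -
    let ?i = "i + k + 1" and ?j = "j + 1"
    let ?p = "poly (lagrange_poly \<sigma> k ?j) ((\<sigma> ?i)\<^sup>2)"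
    have i': "?i \<in> {k<..n}" "?i \<in> {1..n}" and j': "?j \<in> {1..k}" "?j \<in> {1..n}" using ij k by auto
    have p: "\<bar>?p\<bar> \<le> L"
    proof (rule order_trans[OF abs_lagrange_poly_le L_upper[OF j'(1)]])
      fix l assume "l \<in> {1..k}"
      then show "(\<sigma> ?i)\<^sup>2 \<le> (\<sigma> l)\<^sup>2"
        using anti[of ?i l] pos[OF i'(2)] i' by (intro power_mono) auto
    qed simp
    have "c ?i / c ?j \<le> \<rho>"
      using ratio[OF i'(1) j'(1)] c[OF j'(1)] by (simp add: divide_le_eq)
    have "\<bar>Delta n U \<sigma> b k $$ (i, j)\<bar> = \<sigma> ?i / \<sigma> ?j * (c ?i / c ?j * \<bar>?p\<bar>)"
      using ij pos[OF i'(2)] pos[OF j'(2)] by (simp add: \<Delta> c_def abs_mult)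
    also have "\<dots> \<le> \<sigma> ?i / \<sigma> ?j * (\<rho> * L)"
      using \<open>c ?i / c ?j \<le> \<rho>\<close> p pos[OF i'(2)] pos[OF j'(2)] \<rho>
      by (intro mult_left_mono mult_mono) auto
    finally have "\<bar>Delta n U \<sigma> b k $$ (i, j)\<bar>\<^sup>2 \<le> (\<sigma> ?i / \<sigma> ?j * (\<rho> * L))\<^sup>2"
      by (intro power_mono) auto
    also have "\<dots> = (\<rho> * L)\<^sup>2 * (\<sigma> ?i / \<sigma> ?j)\<^sup>2"
      by (simp add: power_mult_distrib power_divide ac_simps)
    also have "\<sigma> ?i / \<sigma> ?j = real ?i powr (- \<alpha>) * real ?j powr \<alpha>"
      unfolding \<sigma>[OF i'(2)] \<sigma>[OF j'(2)] using \<zeta> by (simp add: powr_minus field_simps)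
    also have "(real ?i powr (- \<alpha>) * real ?j powr \<alpha>)\<^sup>2 = x ?i * y ?j"
      by (simp add: x_def y_def power_mult_distrib powr_power mult.commute)
    finally show ?thesis by simp
  qed
  have "mat_norm2 (Delta n U \<sigma> b k) \<le> sqrt (\<Sum>i<n - k. \<Sum>j<k. (Delta n U \<sigma> b k $$ (i, j))\<^sup>2)"
    using k by (intro mat_norm2_le_Frobenius) (auto simp: \<Delta>)
  also have "\<dots> \<le> sqrt (\<Sum>i<n - k. \<Sum>j<k. (\<rho> * L)\<^sup>2 * (x (i + k + 1) * y (j + 1)))"
    by (intro real_sqrt_le_mono sum_mono entry) auto
  also have "(\<Sum>i<n - k. \<Sum>j<k. (\<rho> * L)\<^sup>2 * (x (i + k + 1) * y (j + 1))) =
      (\<rho> * L)\<^sup>2 * ((\<Sum>i<n - k. x (i + k + 1)) * (\<Sum>j<k. y (j + 1)))"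
    by (subst sum_product) (simp add: sum_distrib_left)
  also have "(\<Sum>i<n - k. x (i + k + 1)) = (\<Sum>i\<in>{k<..n}. x i)"
    using k by (intro sum.reindex_bij_witness[of _ "\<lambda>i. i - k - 1" "\<lambda>i. i + k + 1"]) auto
  also have "(\<Sum>j<k. y (j + 1)) = (\<Sum>j\<in>{1..k}. y j)"
    by (intro sum.reindex_bij_witness[of _ "\<lambda>j. j - 1" "\<lambda>j. j + 1"]) auto
  finally show ?thesis
    using \<rho> L by (simp add: real_sqrt_mult x_def y_def L_def mult.commute mult.left_commute)
qed

theorem theorem3:
  fixes A U V :: "real mat" and b bhat e :: "real vec" and \<sigma> :: "nat \<Rightarrow> real"
    and m n k0 :: nat and \<alpha> \<beta> \<zeta> \<eta> :: real
  assumes "n \<le> m"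
    and "is_svd m n A U \<sigma> V"
    and "\<alpha> > 1 / 2" and "\<zeta> > 0"
    and "\<forall>j\<in>{1..n}. \<sigma> j = \<zeta> * real j powr (- \<alpha>)"
    and "\<beta> > 0"
    and "discrete_picard m n U \<sigma> \<beta> \<eta> k0 b bhat e"
  shows "\<forall>k\<in>{1..n - 1}.
    (let Vk = right_singular_space n V k;
         VkR = krylov_space n (transpose_mat A * A) (transpose_mat A *\<^sub>v b) k;
         \<Delta> = Delta n U \<sigma> b k
     in mat_norm2 (sin_Theta n Vk VkR) = mat_norm2 \<Delta> / sqrt (1 + (mat_norm2 \<Delta>)\<^sup>2)
      \<and> mat_norm2 (tan_Theta n Vk VkR) = mat_norm2 \<Delta>
      \<and> (k = 1 \<longrightarrow>
           mat_norm2 \<Delta> \<le> \<sigma> 2 powr (1 + \<beta>) / \<sigma> 1 powr (1 + \<beta>) * sqrt (1 / (2 * \<alpha> - 1)))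
      \<and> (2 \<le> k \<and> k \<le> k0 \<longrightarrow>
           mat_norm2 \<Delta> \<le> \<sigma> (k + 1) powr (1 + \<beta>) / \<sigma> k powr (1 + \<beta>)
             * sqrt ((real k)\<^sup>2 / (4 * \<alpha>\<^sup>2 - 1) + real k / (2 * \<alpha> - 1)) * lagrange0_max \<sigma> k)
      \<and> (k0 + 1 \<le> k \<longrightarrow>
           mat_norm2 \<Delta> \<le> sqrt ((real k)\<^sup>2 / (4 * \<alpha>\<^sup>2 - 1) + real k / (2 * \<alpha> - 1))
             * lagrange0_max \<sigma> k))"
proof
  fix k assume "k \<in> {1..n - 1}"
  then have k: "1 \<le> k" "k < n" by auto
  define c where "c = (\<lambda>j. \<bar>col U (j - 1) \<bullet> b\<bar>)"
  define d where "d = (\<lambda>i. \<sigma> (i + 1) * (col U i \<bullet> b))"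
  define \<Delta> where "\<Delta> = Delta n U \<sigma> b k"
  have \<sigma>: "\<sigma> j = \<zeta> * real j powr (- \<alpha>)" if "j \<in> {1..n}" for j using assms(5) that by blast
  have pos: "0 < \<sigma> j" if "j \<in> {1..n}" for j using \<sigma>[OF that] assms(4) that by simp
  have b: "b \<in> carrier_vec m" and \<eta>: "0 < \<eta>" and k0: "1 \<le> k0" "k0 < n"
    and c_signal: "\<And>j. j \<in> {1..k0} \<Longrightarrow> c j = \<sigma> j powr (1 + \<beta>)"
    and c_noise: "\<And>j. j \<in> {k0<..n} \<Longrightarrow> c j = \<eta>"
    and c_Suc: "\<And>j. j \<in> {1..<n} \<Longrightarrow> c (j + 1) \<le> c j"
    and ratio_signal: "\<And>j. j \<in> {1..k0} \<Longrightarrow> c (j + 1) / c j = (\<sigma> (j + 1) / \<sigma> j) powr (1 + \<beta>)"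
    and ratio_noise: "\<And>j. j \<in> {k0<..<n} \<Longrightarrow> c (j + 1) / c j = 1"
    using assms(7) unfolding discrete_picard_def Let_def c_def by blast+
  have c_pos: "0 < c j" if "j \<in> {1..n}" for j
    using c_signal[of j] c_noise[of j] \<eta> pos[OF that] that by (cases "j \<le> k0") auto
  have c_anti: "c j \<le> c i" if "1 \<le> i" "i \<le> j" "j \<le> n" for i j
    using that(2,3)
  proof (induction j rule: dec_induct)
    case (step j)
    then show ?case using c_Suc[of j] that(1) by auto
  qed simp
  have d_nz: "d i \<noteq> 0" if "i < k" for i
    using c_pos[of "i + 1"] pos[of "i + 1"] that k by (auto simp: d_def c_def)
  have \<sigma>_strict: "\<sigma> j < \<sigma> i" if "1 \<le> i" "i < j" "j \<le> n" for i j
    using that \<sigma>[of i] \<sigma>[of j] assms(3,4) powr_less_mono2_neg[of "- \<alpha>" "real i" "real j"] by auto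
  have inj: "inj_on (\<lambda>i. (\<sigma> i)\<^sup>2) {1..k}"
  proof (rule inj_onI)
    fix i j assume ij: "i \<in> {1..k}" "j \<in> {1..k}" and "(\<sigma> i)\<^sup>2 = (\<sigma> j)\<^sup>2"
    then have "\<sigma> i = \<sigma> j" using pos[of i] pos[of j] k by simp
    then show "i = j"
      using \<sigma>_strict[of i j] \<sigma>_strict[of j i] ij k by (cases i j rule: linorder_cases) auto
  qed
  note Delta_facts = Delta_eq[where n = n and k = k and U = U and \<sigma> = \<sigma> and b = b,
      OF less_imp_le[OF k(2)] inj d_nz[unfolded d_def]]
  have \<Delta>_entries: "\<Delta> = mat (n - k) k (\<lambda>(i, j). \<sigma> (i + k + 1) * (col U (i + k) \<bullet> b) *
      poly (lagrange_poly \<sigma> k (j + 1)) ((\<sigma> (i + k + 1))\<^sup>2) / (\<sigma> (j + 1) * (col U j \<bullet> b)))"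
    unfolding \<Delta>_def by (rule Delta_facts(1))
  have \<Delta>_carrier: "\<Delta> \<in> carrier_mat (n - k) k" unfolding \<Delta>_entries by simp
  \<comment> \<open>Since the coefficients of \<open>b\<close> decrease, the ratio of two consecutive ones at \<open>k\<close> bounds
    every ratio of a trailing to a leading one.\<close>
  have bound: "mat_norm2 \<Delta> \<le> \<rho> *
      sqrt ((\<Sum>i\<in>{k<..n}. real i powr (- 2 * \<alpha>)) * (\<Sum>j\<in>{1..k}. real j powr (2 * \<alpha>))) *
      lagrange0_max \<sigma> k"
    if \<rho>: "c (k + 1) / c k = \<rho>" for \<rho>
    unfolding \<Delta>_def
  proof (rule norm_Delta_le[OF k assms(4) _ \<sigma>])
    have ck: "c (k + 1) = \<rho> * c k" using \<rho> c_pos[of k] k by (auto simp: field_simps)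
    show \<rho>0: "0 \<le> \<rho>" using \<rho> by (auto simp: c_def)
    fix i j assume i: "i \<in> {k<..n}" and j: "j \<in> {1..k}"
    have "c i \<le> c (k + 1)" using i by (intro c_anti) auto
    also have "\<dots> \<le> \<rho> * c j" unfolding ck using j k \<rho>0 by (intro mult_left_mono c_anti) auto
    finally show "\<bar>col U (i - 1) \<bullet> b\<bar> \<le> \<rho> * \<bar>col U (j - 1) \<bullet> b\<bar>" by (simp add: c_def)
  qed (use assms(3) c_pos k \<Delta>_entries[unfolded \<Delta>_def] in \<open>auto simp: c_def\<close>)
  have sums: "sqrt ((\<Sum>i\<in>{k<..n}. real i powr (- 2 * \<alpha>)) * (\<Sum>j\<in>{1..k}. real j powr (2 * \<alpha>)))
      \<le> sqrt ((real k)\<^sup>2 / (4 * \<alpha>\<^sup>2 - 1) + real k / (2 * \<alpha> - 1))"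
    using sum_powr_product_le[OF assms(3) k(1)] k by (intro real_sqrt_le_mono) auto
  have L: "0 \<le> lagrange0_max \<sigma> k" by (rule lagrange0_max_nonneg[OF k(1)])
  have \<rho>_signal: "c (k + 1) / c k = \<sigma> (k + 1) powr (1 + \<beta>) / \<sigma> k powr (1 + \<beta>)" if "k \<le> k0"
    using ratio_signal[of k] that k pos[of k] pos[of "k + 1"] by (simp add: powr_divide)

  define V1 where "V1 = mat n k (\<lambda>(i, j). V $$ (i, j))"
  define V2 where "V2 = mat n (n - k) (\<lambda>(i, j). V $$ (i, j + k))"
  have V: "V \<in> carrier_mat n n" "V\<^sup>T * V = 1\<^sub>m n" using assms(2) by (auto simp: is_svd_def)
  have Vk: "right_singular_space n V k = vec_space.col_space n V1"
    unfolding V1_def using k by (intro right_singular_space_eq_col_space[OF V(1)]) simp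
  have VkR: "krylov_space n (A\<^sup>T * A) (A\<^sup>T *\<^sub>v b) k = vec_space.col_space n (V1 + V2 * \<Delta>)"
    unfolding V1_def V2_def \<Delta>_def
    by (rule krylov_space_eq_graph[OF assms(1,2) b less_imp_le[OF k(2)] inj d_nz[unfolded d_def]])
  have graph: "graph_subspace n k (n - k) V1 V2 \<Delta>"
    unfolding V1_def V2_def using graph_subspace_column_blocks[OF V k(1) _ \<Delta>_carrier] k by simp
  note angles = graph_subspace.norm_sin_Theta[OF graph] graph_subspace.norm_tan_Theta[OF graph]

  have k_one: "mat_norm2 \<Delta> \<le> \<sigma> 2 powr (1 + \<beta>) / \<sigma> 1 powr (1 + \<beta>) * sqrt (1 / (2 * \<alpha> - 1))"
    if "k = 1"
  proof -
    have "lagrange0_max \<sigma> k = 1"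
      using that by (simp add: lagrange0_max_def lagrange0_def)
    then have "mat_norm2 \<Delta> \<le> \<sigma> 2 powr (1 + \<beta>) / \<sigma> 1 powr (1 + \<beta>) *
        sqrt (\<Sum>i\<in>{1<..n}. real i powr (- 2 * \<alpha>))"
      using bound[OF \<rho>_signal] that k0 by (simp add: numeral_2_eq_2)
    also have "\<dots> \<le> \<sigma> 2 powr (1 + \<beta>) / \<sigma> 1 powr (1 + \<beta>) * sqrt (1 / (2 * \<alpha> - 1))"
      using sum_powr_tail_one[OF assms(3), of n] k
      by (intro mult_left_mono real_sqrt_le_mono) auto
    finally show ?thesis .
  qed
  have k_signal: "mat_norm2 \<Delta> \<le> \<sigma> (k + 1) powr (1 + \<beta>) / \<sigma> k powr (1 + \<beta>) *
      sqrt ((real k)\<^sup>2 / (4 * \<alpha>\<^sup>2 - 1) + real k / (2 * \<alpha> - 1)) * lagrange0_max \<sigma> k"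
    if "k \<le> k0"
    using sums L by (intro order_trans[OF bound[OF \<rho>_signal[OF that]]] mult_right_mono mult_left_mono) auto
  have k_noise: "mat_norm2 \<Delta> \<le> sqrt ((real k)\<^sup>2 / (4 * \<alpha>\<^sup>2 - 1) + real k / (2 * \<alpha> - 1)) *
      lagrange0_max \<sigma> k"
    if "k0 + 1 \<le> k"
  proof -
    have "c (k + 1) / c k = 1" using ratio_noise[of k] that k by auto
    from bound[OF this] show ?thesis using sums L by (auto elim!: order_trans intro!: mult_right_mono)
  qed
  show "let Vk = right_singular_space n V k;
         VkR = krylov_space n (transpose_mat A * A) (transpose_mat A *\<^sub>v b) k;
         \<Delta> = Delta n U \<sigma> b k
     in mat_norm2 (sin_Theta n Vk VkR) = mat_norm2 \<Delta> / sqrt (1 + (mat_norm2 \<Delta>)\<^sup>2)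
      \<and> mat_norm2 (tan_Theta n Vk VkR) = mat_norm2 \<Delta>
      \<and> (k = 1 \<longrightarrow>
           mat_norm2 \<Delta> \<le> \<sigma> 2 powr (1 + \<beta>) / \<sigma> 1 powr (1 + \<beta>) * sqrt (1 / (2 * \<alpha> - 1)))
      \<and> (2 \<le> k \<and> k \<le> k0 \<longrightarrow>
           mat_norm2 \<Delta> \<le> \<sigma> (k + 1) powr (1 + \<beta>) / \<sigma> k powr (1 + \<beta>)
             * sqrt ((real k)\<^sup>2 / (4 * \<alpha>\<^sup>2 - 1) + real k / (2 * \<alpha> - 1)) * lagrange0_max \<sigma> k)
      \<and> (k0 + 1 \<le> k \<longrightarrow>
           mat_norm2 \<Delta> \<le> sqrt ((real k)\<^sup>2 / (4 * \<alpha>\<^sup>2 - 1) + real k / (2 * \<alpha> - 1))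
             * lagrange0_max \<sigma> k)"
    unfolding Let_def Vk VkR \<Delta>_def[symmetric]
    using angles[unfolded graph_subspace.W_def[OF graph]] k_one k_signal k_noise by blast
qed

end
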